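(* Let $D$ be the closed square with vertices $(\pm1,0)$ and $(0,\pm1)$, and let $C_1=\{(x,y)\in\mathbb{R}^2: |x|\le1,\ |y|\le1,\ \sqrt{1-|x|}+\sqrt{1-|y|}=1\}$. Then the scaled generalized Jarník polygons $\tilde P_Q(D)$ converge to $C_1$ as $Q\to\infty$: for every $\varepsilon>0$ there is $Q_0(\varepsilon)$ such that for all integers $Q>Q_0(\varepsilon)$, every point of $\tilde P_Q(D)$ lies at distance less than $\varepsilon$ from $C_1$.
   Context: For a set $S\subset\mathbb{R}^2$ and a positive integer $Q$, let $V_Q(S)=\{(a,b)\in\mathbb{Z}^2:\gcd(a,b)=1,\ (a/Q,b/Q)\in S\}$. For $S$ that is symmetric under the dihedral group of order eight generated by reflections in the coordinate axes and the line $y=x$, the generalized Jarník polygon $P_Q(S)$ is the convex polygon, unique up to translation, whose edges (as vectors, traversed counterclockwise) are exactly the vectors of $V_Q(S)$; it has eight-fold dihedral symmetry about its center. The scaled polygon $\tilde P_Q(S)$ is obtained by translating $P_Q(S)$ so that its center is the origin and scaling by a positive factor so that the edge corresponding to the vector $(1,0)$ has midpoint $(0,-1)$ (so $\tilde P_Q(S)$ passes through $(\pm1,0)$ and $(0,\pm1)$). Polygons are regarded as closed curves. *)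

theory Defs
  imports "HOL-Analysis.Analysis"
begin

definition V :: "nat \<Rightarrow> (real \<times> real) set \<Rightarrow> (real \<times> real) set" where
  "V Q S = {(of_int a, of_int b) | a b :: int.
              gcd a b = 1 \<and> (of_int a / of_nat Q, of_int b / of_nat Q) \<in> S}"

definition cross2 :: "real \<times> real \<Rightarrow> real \<times> real \<Rightarrow> real" where
  "cross2 u v = fst u * snd v - snd u * fst v"

text \<open>
  Convex polygons are represented by the filled region \<open>K\<close>, a polytope in the plane; the polygon as
  a closed curve is \<open>frontier K\<close>. An edge of \<open>K\<close> is traversed counterclockwise from \<open>p\<close> to \<open>q\<close> if
  \<open>K\<close> lies to its left.
\<close>

definition ccw_edge :: "(real \<times> real) set \<Rightarrow> real \<times> real \<Rightarrow> real \<times> real \<Rightarrow> bool" where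
  "ccw_edge K p q \<longleftrightarrow> closed_segment p q edge_of K \<and> (\<forall>z\<in>K. cross2 (q - p) (z - p) \<ge> 0)"

text \<open>
  Equality of sets suffices to say that the edge vectors are exactly those of \<open>V Q S\<close>: distinct
  edges of a convex polygon, oriented counterclockwise, have distinct directions.
\<close>

definition is_jarnik_polygon :: "nat \<Rightarrow> (real \<times> real) set \<Rightarrow> (real \<times> real) set \<Rightarrow> bool" where
  "is_jarnik_polygon Q S K \<longleftrightarrow> polytope K \<and> {q - p | p q. ccw_edge K p q} = V Q S"

definition dihedral_symmetric :: "(real \<times> real) set \<Rightarrow> bool" where
  "dihedral_symmetric S \<longleftrightarrow>
     (\<forall>x y. (x, y) \<in> S \<longrightarrow> (- x, y) \<in> S \<and> (x, - y) \<in> S \<and> (y, x) \<in> S)"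

text \<open>
  The center of \<open>K\<close> is the point \<open>c\<close> such that \<open>K\<close>, translated by \<open>- c\<close>, has the eight-fold
  dihedral symmetry.
\<close>

definition is_scaled_jarnik_polygon :: "nat \<Rightarrow> (real \<times> real) set \<Rightarrow> (real \<times> real) set \<Rightarrow> bool" where
  "is_scaled_jarnik_polygon Q S P \<longleftrightarrow>
     (\<exists>K c s. is_jarnik_polygon Q S K \<and> dihedral_symmetric ((\<lambda>z. z - c) ` K) \<and> s > 0 \<and>
        (\<exists>p q. ccw_edge K p q \<and> q - p = (1, 0) \<and> s *\<^sub>R (midpoint p q - c) = (0, - 1)) \<and>
        P = (\<lambda>z. s *\<^sub>R (z - c)) ` frontier K)"

text \<open>
  For \<open>Q > 0\<close> and dihedrally symmetric bounded \<open>S\<close> with \<open>(1, 0) \<in> V Q S\<close> there is such a \<open>P\<close>, and only one: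
  \<open>K\<close> is unique up to translation, and its center and the scaling factor are then determined.
\<close>

definition scaled_jarnik_polygon :: "nat \<Rightarrow> (real \<times> real) set \<Rightarrow> (real \<times> real) set" where
  "scaled_jarnik_polygon Q S = (THE P. is_scaled_jarnik_polygon Q S P)"

definition diamond :: "(real \<times> real) set" where
  "diamond = convex hull {(1, 0), (- 1, 0), (0, 1), (0, - 1)}"

definition limit_curve :: "(real \<times> real) set" where
  "limit_curve =
     {(x, y). \<bar>x\<bar> \<le> 1 \<and> \<bar>y\<bar> \<le> 1 \<and> sqrt (1 - \<bar>x\<bar>) + sqrt (1 - \<bar>y\<bar>) = 1}"

end

theory Submission imports Defs begin

text \<open>
  A polygon is determined by its edge vectors up to translation, so the generalized Jarnik polygon of a
  symmetric finite set \<open>W\<close> of directions is a zonotope, with support function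
  \<open>u \<mapsto> (\<Sum>v\<in>W. \<bar>u \<bullet> v\<bar>) / 4\<close>. For primitive vectors in the dilated diamond, after normalization, this
  converges uniformly on \<open>\<bar>\<alpha>\<bar> + \<bar>\<beta>\<bar> = 1\<close> to \<open>1 - \<bar>\<alpha>\<bar> * \<bar>\<beta>\<bar>\<close>: the sum over all lattice points is computed
  along the level sets of the 1-norm, and primitivity affects every direction by the same constant factor up
  to lower order. The limit is the support function of the region bounded by \<^term>\<open>limit_curve\<close>, and convergence
  of support functions moves each frontier point to the curve by a dilation with factor close to 1.
\<close>

section \<open>Edges of planar polygons\<close>

text \<open>The scaled polygon is a definite description, so before any estimate a polygon with the
  given edge vectors must be shown to exist, and its shape, center and scale to be forced. There is
  no enumeration of the vertices to walk along. Instead, the extreme vertex is followed as the outer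
  normal turns, with ties broken lexicographically, so that it is unique even when the normal
  belongs to an edge.

  The obstacle in the arithmetic part is uniformity: the errors must not depend on the direction.
  For this reason the density of primitive vectors is never computed. The sum in direction
  (\<alpha>, \<beta>) is compared with 1 - \<alpha>\<beta> times the sum in the axis direction (0,
  1). For all lattice points the cubic main terms then cancel, and the discrepancy for primitive
  points obeys a recursion over the quotients \<open>n div d\<close> whose constants are the same
  for every direction. A crude cubic lower bound for the axis sum is enough to divide by it.\<close>

definition rot :: "real \<times> real \<Rightarrow> real \<times> real" where
  "rot u = (- snd u, fst u)"

lemma inner_pair: "u \<bullet> v = fst u * fst v + snd u * snd v" for u v :: "real \<times> real"
  by (cases u; cases v) simp

lemma rot_zero_iff [simp]: "rot u = 0 \<longleftrightarrow> u = 0"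
  by (auto simp: rot_def prod_eq_iff)

lemma rot_rot [simp]: "rot (rot u) = - u"
  by (cases u) (auto simp: rot_def)

lemma rot_minus [simp]: "rot (- u) = - rot u"
  by (cases u) (auto simp: rot_def)

lemma rot_scaleR [simp]: "rot (c *\<^sub>R u) = c *\<^sub>R rot u"
  by (cases u) (auto simp: rot_def)

lemma inner_rot_self [simp]: "u \<bullet> rot u = 0" "rot u \<bullet> u = 0"
  by (auto simp: rot_def inner_pair)

lemma inner_rot_rot [simp]: "rot u \<bullet> rot v = u \<bullet> v"
  by (auto simp: rot_def inner_pair)

lemma cross2_eq_inner_rot: "cross2 u v = rot u \<bullet> v"
  by (auto simp: rot_def inner_pair cross2_def)

lemma rot_decompose:
  assumes "u \<noteq> 0"
  shows "z = ((u \<bullet> z) / (u \<bullet> u)) *\<^sub>R u + ((rot u \<bullet> z) / (u \<bullet> u)) *\<^sub>R rot u"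
proof -
  have "(u \<bullet> z) *\<^sub>R u + (rot u \<bullet> z) *\<^sub>R rot u = (u \<bullet> u) *\<^sub>R z"
    by (auto simp: rot_def inner_pair prod_eq_iff algebra_simps)
  then have "(1 / (u \<bullet> u)) *\<^sub>R ((u \<bullet> z) *\<^sub>R u + (rot u \<bullet> z) *\<^sub>R rot u) = z"
    using assms by simp
  then show ?thesis
    by (simp add: scaleR_right_distrib)
qed

lemma orthogonal_imp_scaleR_rot:
  assumes "u \<noteq> 0" "u \<bullet> z = 0"
  shows "z = ((rot u \<bullet> z) / (u \<bullet> u)) *\<^sub>R rot u"
  using rot_decompose[OF assms(1), of z] assms(2) by simp

section \<open>Lexicographic comparison along a direction\<close>

definition lexnn :: "real \<times> real \<Rightarrow> real \<times> real \<Rightarrow> real \<times> real \<Rightarrow> bool" where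
  "lexnn u w z \<longleftrightarrow> u \<bullet> z > 0 \<or> (u \<bullet> z = 0 \<and> w \<bullet> z \<ge> 0)"

lemma lexnn_zero [simp]: "lexnn u w 0"
  by (simp add: lexnn_def)

lemma lexnn_add: "lexnn u w x \<Longrightarrow> lexnn u w y \<Longrightarrow> lexnn u w (x + y)"
  by (auto simp: lexnn_def inner_add_right)

lemma lexnn_scaleR: "lexnn u w x \<Longrightarrow> c \<ge> 0 \<Longrightarrow> lexnn u w (c *\<^sub>R x)"
  by (cases "c = 0") (auto simp: lexnn_def)

lemma lexnn_sum: "(\<And>i. i \<in> A \<Longrightarrow> lexnn u w (f i)) \<Longrightarrow> lexnn u w (sum f A)"
  by (induction A rule: infinite_finite_induct) (auto intro: lexnn_add)

lemma lexnn_total: "lexnn u w x \<or> lexnn u w (- x)"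
  by (auto simp: lexnn_def)

text \<open>The two orientations of the tie-break, \<open>rot u\<close> and \<open>- rot u\<close>,
  select the last and the first point of a face in counterclockwise order. Either one makes the
  comparison a total order on the plane, so maxima are unique.\<close>

lemma lexnn_antisym:
  assumes "u \<noteq> 0" "w = rot u \<or> w = - rot u" "lexnn u w x" "lexnn u w (- x)"
  shows "x = 0"
proof -
  have "u \<bullet> x = 0" "rot u \<bullet> x = 0"
    using assms(2-4) by (auto simp: lexnn_def)
  then show ?thesis
    using rot_decompose[OF assms(1), of x] by simp
qed

lemma lexnn_pos_multiple: "c > 0 \<Longrightarrow> d > 0 \<Longrightarrow> lexnn (c *\<^sub>R u) (d *\<^sub>R w) x \<longleftrightarrow> lexnn u w x"
  by (auto simp: lexnn_def zero_less_mult_iff zero_le_mult_iff)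

text \<open>For nonzero \<open>u\<close> the lexicographic cone is not closed, so its maxima are not
  obtained from compactness. Convexity is what carries a maximum over finitely many generators to
  their hull.\<close>

lemma convex_lexnn_diff: "convex {x. lexnn u w (a - x)}"
proof (rule convexI)
  fix x y and s t :: real
  assume *: "x \<in> {x. lexnn u w (a - x)}" "y \<in> {x. lexnn u w (a - x)}" "0 \<le> s" "0 \<le> t" "s + t = 1"
  have "a - (s *\<^sub>R x + t *\<^sub>R y) = (s + t) *\<^sub>R a - (s *\<^sub>R x + t *\<^sub>R y)"
    using * by simp
  also have "\<dots> = s *\<^sub>R (a - x) + t *\<^sub>R (a - y)"
    by (simp add: algebra_simps)
  finally show "s *\<^sub>R x + t *\<^sub>R y \<in> {x. lexnn u w (a - x)}"
    using * by (auto intro!: lexnn_add lexnn_scaleR)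
qed

definition lexmax :: "real \<times> real \<Rightarrow> real \<times> real \<Rightarrow> (real \<times> real) set \<Rightarrow> real \<times> real \<Rightarrow> bool" where
  "lexmax u w K a \<longleftrightarrow> a \<in> K \<and> (\<forall>z\<in>K. lexnn u w (a - z))"

lemma lexmax_exists:
  assumes "finite X" "X \<noteq> {}"
  shows "\<exists>a. lexmax u w X a"
  using assms
proof (induction rule: finite_ne_induct)
  case (singleton x)
  then show ?case by (auto simp: lexmax_def)
next
  case (insert x F)
  then obtain a where a: "lexmax u w F a" by blast
  show ?case
  proof (cases "lexnn u w (a - x)")
    case True
    then have "lexmax u w (insert x F) a"
      using a by (auto simp: lexmax_def)
    then show ?thesis ..
  next
    case False
    then have "lexnn u w (x - a)"
      using lexnn_total[of u w "a - x"] by simp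
    then have "lexnn u w (x - z)" if "z \<in> F" for z
      using lexnn_add[of u w "x - a" "a - z"] a that by (auto simp: lexmax_def)
    then have "lexmax u w (insert x F) x"
      by (auto simp: lexmax_def)
    then show ?thesis ..
  qed
qed

lemma lexmax_unique:
  assumes "u \<noteq> 0" "w = rot u \<or> w = - rot u" "lexmax u w K a" "lexmax u w K b"
  shows "a = b"
  using lexnn_antisym[of u w "a - b"] assms by (auto simp: lexmax_def)

lemma lexmax_convex_hull:
  assumes "lexmax u w X a"
  shows "lexmax u w (convex hull X) a"
proof -
  have "convex hull X \<subseteq> {x. lexnn u w (a - x)}"
    using assms by (intro hull_minimal convex_lexnn_diff) (auto simp: lexmax_def)
  then show ?thesis
    using assms by (auto simp: lexmax_def hull_inc)
qed

lemma lexmax_pos_multiple: "c > 0 \<Longrightarrow> d > 0 \<Longrightarrow> lexmax (c *\<^sub>R u) (d *\<^sub>R w) K a \<longleftrightarrow> lexmax u w K a"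
  by (simp add: lexmax_def lexnn_pos_multiple)

lemma lexmax_inner_le: "lexmax u w K a \<Longrightarrow> z \<in> K \<Longrightarrow> u \<bullet> z \<le> u \<bullet> a"
  by (force simp: lexmax_def lexnn_def inner_diff_right)

section \<open>Edges as pairs of lexicographic maxima\<close>

lemma line_point_in_open_segment:
  fixes p d :: "real \<times> real"
  assumes "r < s" "s < t" "d \<noteq> 0"
  shows "p + s *\<^sub>R d \<in> open_segment (p + r *\<^sub>R d) (p + t *\<^sub>R d)"
proof -
  define u where "u = (s - r) / (t - r)"
  have u: "0 < u" "u < 1" "u * (t - r) = s - r"
    using assms by (auto simp: u_def field_simps)
  then have us: "(1 - u) * r + u * t = s"
    by (simp add: algebra_simps)
  have "(1 - u) *\<^sub>R (p + r *\<^sub>R d) + u *\<^sub>R (p + t *\<^sub>R d) = p + ((1 - u) * r + u * t) *\<^sub>R d"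
    by (simp add: algebra_simps)
  then show ?thesis
    using u us assms by (auto simp: in_segment)
qed

text \<open>Here \<open>u\<close> is the outer normal, with \<open>rot u = q - p\<close>. The
  endpoints are extreme among all points of \<open>K\<close> on the supporting line because the edge
  is a face.\<close>

lemma ccw_edge_imp_lexmax:
  assumes "ccw_edge K p q"
  defines "u \<equiv> - rot (q - p)"
  shows "p \<noteq> q" "lexmax u (- rot u) K p" "lexmax u (rot u) K q"
proof -
  have face: "closed_segment p q face_of K" and "aff_dim (closed_segment p q) = 1"
    and left: "\<And>z. z \<in> K \<Longrightarrow> rot (q - p) \<bullet> (z - p) \<ge> 0"
    using assms(1) by (auto simp: ccw_edge_def edge_of_def cross2_eq_inner_rot)
  then show pq': "p \<noteq> q" by auto
  then have u0: "u \<noteq> 0" by (simp add: u_def)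
  have ru: "rot u = q - p" by (simp add: u_def)
  have pq: "p \<in> K" "q \<in> K"
    using face_of_imp_subset[OF face] by auto
  have on_line: "\<exists>t\<ge>0. t \<le> 1 \<and> z = p + t *\<^sub>R (q - p)" if "z \<in> K" "u \<bullet> (p - z) = 0" for z
  proof -
    have "u \<bullet> (z - p) = 0"
      using that(2) by (simp add: inner_diff_right)
    then obtain t where "z - p = t *\<^sub>R (q - p)"
      using orthogonal_imp_scaleR_rot[OF u0, of "z - p"] ru by metis
    then have t: "z = p + t *\<^sub>R (q - p)"
      by (simp add: algebra_simps)
    \<comment> \<open>A point of \<open>K\<close> on the line beyond \<open>p\<close> or
      \<open>q\<close> would put that endpoint inside an open segment with both ends in
      \<open>K\<close>; the face property then pulls the point back into the edge.\<close>
    have "z \<in> closed_segment p q" if "t < 0 \<or> t > 1"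
    proof -
      have "p \<in> open_segment z q \<or> q \<in> open_segment p z"
        using line_point_in_open_segment[of t 0 1 "q - p" p]
          line_point_in_open_segment[of 0 1 t "q - p" p] pq' t that by auto
      then show ?thesis
        using face \<open>z \<in> K\<close> pq unfolding face_of_def by (metis ends_in_segment)
    qed
    then have "z \<in> closed_segment p q \<or> (0 \<le> t \<and> t \<le> 1)"
      by fastforce
    then show ?thesis
    proof
      assume "z \<in> closed_segment p q"
      then obtain v where "0 \<le> v" "v \<le> 1" "z = (1 - v) *\<^sub>R p + v *\<^sub>R q"
        by (auto simp: in_segment)
      then show ?thesis
        by (auto simp: algebra_simps intro!: exI[of _ v])
    qed (use t in blast)
  qed
  have le: "u \<bullet> (p - z) \<ge> 0" if "z \<in> K" for z
    using left[OF that] by (simp add: u_def inner_diff_right)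
  have *: "u \<bullet> (q - p) = 0"
    using inner_rot_self(1)[of u] ru by simp
  have "lexnn u (- rot u) (p - z) \<and> lexnn u (rot u) (q - z)" if z: "z \<in> K" for z
  proof (cases "u \<bullet> (p - z) = 0")
    case True
    then obtain t where t: "t \<ge> 0" "t \<le> 1" "z = p + t *\<^sub>R (q - p)"
      using on_line z by blast
    then have "p - z = (- t) *\<^sub>R rot u" "q - z = (1 - t) *\<^sub>R rot u"
      by (simp_all add: ru algebra_simps)
    moreover have "lexnn u (- rot u) ((- t) *\<^sub>R rot u)" "lexnn u (rot u) ((1 - t) *\<^sub>R rot u)"
      using t by (simp_all add: lexnn_def)
    ultimately show ?thesis
      by simp
  next
    case False
    then have "u \<bullet> (p - z) > 0"
      using le[OF z] by simp
    moreover have "u \<bullet> (q - z) = u \<bullet> (p - z)"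
      using * by (simp add: inner_diff_right)
    ultimately show ?thesis
      by (simp add: lexnn_def)
  qed
  then show "lexmax u (- rot u) K p" "lexmax u (rot u) K q"
    using pq by (auto simp: lexmax_def)
qed

lemma lexmax_diff:
  assumes "u \<noteq> 0" "lexmax u (- rot u) K a" "lexmax u (rot u) K b"
  obtains t where "t \<ge> 0" "b - a = t *\<^sub>R rot u"
proof -
  have "lexnn u (- rot u) (a - b)" "lexnn u (rot u) (b - a)"
    using assms by (auto simp: lexmax_def)
  then have "u \<bullet> (b - a) = 0" "rot u \<bullet> (b - a) \<ge> 0"
    by (auto simp: lexnn_def inner_diff_right)
  then show ?thesis
    using orthogonal_imp_scaleR_rot[OF assms(1), of "b - a"] that
    by (metis divide_nonneg_nonneg inner_ge_zero)
qed

text \<open>Converse of the previous correspondence: \<open>K\<close> meets its supporting line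
  exactly between the two maxima, and such an intersection is a face, of dimension 1 because the
  maxima differ.\<close>

lemma lexmax_imp_ccw_edge:
  assumes K: "convex K" and u0: "u \<noteq> 0"
    and p: "lexmax u (- rot u) K p" and q: "lexmax u (rot u) K q" and "p \<noteq> q"
  shows "ccw_edge K p q"
proof -
  obtain t where t: "t \<ge> 0" "q - p = t *\<^sub>R rot u"
    using lexmax_diff[OF u0 p q] .
  then have t0: "t > 0"
    using \<open>p \<noteq> q\<close> by (cases "t = 0") auto
  have le: "u \<bullet> z \<le> u \<bullet> p" if "z \<in> K" for z
    using lexmax_inner_le[OF p that] .
  have uq: "u \<bullet> q = u \<bullet> p"
    using t(2) by (metis diff_self eq_iff_diff_eq_0 inner_diff_right inner_rot_self(1) inner_scaleR_right mult_zero_right)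
  have pqK: "p \<in> K" "q \<in> K"
    using p q by (auto simp: lexmax_def)
  have "K \<inter> {x. u \<bullet> x = u \<bullet> p} = closed_segment p q"
  proof (intro equalityI subsetI)
    fix z assume z: "z \<in> K \<inter> {x. u \<bullet> x = u \<bullet> p}"
    then have "lexnn u (- rot u) (p - z)" "lexnn u (rot u) (q - z)"
      using p q by (auto simp: lexmax_def)
    then have nn: "rot u \<bullet> (z - p) \<ge> 0" "rot u \<bullet> (q - z) \<ge> 0"
      using z uq by (auto simp: lexnn_def inner_diff_right)
    define s where "s = (rot u \<bullet> (z - p)) / (u \<bullet> u)"
    have s: "z - p = s *\<^sub>R rot u"
      using orthogonal_imp_scaleR_rot[OF u0, of "z - p"] z by (auto simp: s_def inner_diff_right)
    have "s \<ge> 0" using nn by (simp add: s_def)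
    have "q - z = (t - s) *\<^sub>R rot u"
      using s t(2) by (simp add: algebra_simps)
    then have "t - s \<ge> 0"
      using nn(2) u0 inner_gt_zero_iff[of u] by (simp add: zero_le_mult_iff not_le[symmetric] del: inner_gt_zero_iff)
    have "z = p + (s / t) *\<^sub>R (q - p)"
      using s t(2) t0 by (simp add: algebra_simps)
    then show "z \<in> closed_segment p q"
      using \<open>s \<ge> 0\<close> \<open>t - s \<ge> 0\<close> t0
      by (auto simp: in_segment algebra_simps intro!: exI[of _ "s / t"])
  next
    fix z assume z: "z \<in> closed_segment p q"
    then have "z \<in> K"
      using K pqK closed_segment_subset by blast
    moreover have "u \<bullet> z = u \<bullet> p"
      using z uq by (auto simp: in_segment inner_add_right) (simp add: algebra_simps)
    ultimately show "z \<in> K \<inter> {x. u \<bullet> x = u \<bullet> p}" by simp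
  qed
  then have "closed_segment p q face_of K"
    using face_of_Int_supporting_hyperplane_le[OF K le] by metis
  moreover have "aff_dim (closed_segment p q) = 1"
    using \<open>p \<noteq> q\<close> by (simp add: segment_convex_hull aff_dim_convex_hull)
  moreover have "rot (q - p) \<bullet> (z - p) \<ge> 0" if "z \<in> K" for z
    using le[OF that] t0 by (simp add: t(2) inner_diff_right)
  ultimately show ?thesis
    by (simp add: ccw_edge_def edge_of_def cross2_eq_inner_rot)
qed

text \<open>
  The endpoints, in counterclockwise order, of the face of \<open>K\<close> with outer normal \<open>u\<close>; they coincide
  when that face is a vertex.
\<close>

definition edge_start :: "(real \<times> real) set \<Rightarrow> real \<times> real \<Rightarrow> real \<times> real" where
  "edge_start K u = (SOME a. lexmax u (- rot u) K a)"

definition edge_end :: "(real \<times> real) set \<Rightarrow> real \<times> real \<Rightarrow> real \<times> real" where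
  "edge_end K u = (SOME a. lexmax u (rot u) K a)"

lemma lexmax_exists_polytope:
  assumes "polytope K" "K \<noteq> {}"
  shows "\<exists>a. lexmax u w K a"
  using assms lexmax_exists lexmax_convex_hull unfolding polytope_def
  by (metis convex_hull_eq_empty)

lemma lexmax_edge_start:
  assumes "polytope K" "K \<noteq> {}"
  shows "lexmax u (- rot u) K (edge_start K u)"
  unfolding edge_start_def using lexmax_exists_polytope[OF assms] by (rule someI_ex)

lemma lexmax_edge_end:
  assumes "polytope K" "K \<noteq> {}"
  shows "lexmax u (rot u) K (edge_end K u)"
  unfolding edge_end_def using lexmax_exists_polytope[OF assms] by (rule someI_ex)

lemma edge_start_eq:
  assumes "polytope K" "u \<noteq> 0" "lexmax u (- rot u) K a"
  shows "edge_start K u = a"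
proof -
  have "K \<noteq> {}"
    using assms(3) by (auto simp: lexmax_def)
  then show ?thesis
    by (intro lexmax_unique[OF assms(2) _ lexmax_edge_start[OF assms(1)] assms(3)]) simp
qed

lemma edge_end_eq:
  assumes "polytope K" "u \<noteq> 0" "lexmax u (rot u) K a"
  shows "edge_end K u = a"
proof -
  have "K \<noteq> {}"
    using assms(3) by (auto simp: lexmax_def)
  then show ?thesis
    by (intro lexmax_unique[OF assms(2) _ lexmax_edge_end[OF assms(1)] assms(3)]) simp
qed

text \<open>A strict win at \<open>u\<close> over finitely many generators survives near
  \<open>u\<close>. Generators tied at \<open>u\<close> differ by multiples of \<open>rot u\<close>,
  so the sign of \<open>rot u \<bullet> w\<close> decides which end of the face wins; at sign zero
  the start is kept.\<close>

lemma edge_start_rotate: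
  assumes K: "polytope K" "K \<noteq> {}" and u0: "u \<noteq> 0"
  shows "\<forall>\<^sub>F w in nhds u. edge_start K w =
    (if rot u \<bullet> w > 0 then edge_end K u else edge_start K u)"
proof -
  obtain X where X: "finite X" "K = convex hull X"
    using K(1) by (auto simp: polytope_def)
  then have "X \<noteq> {}" using K(2) by auto
  obtain a where "lexmax u (- rot u) X a"
    using lexmax_exists[OF X(1) \<open>X \<noteq> {}\<close>] by blast
  moreover from this have a_eq: "edge_start K u = a"
    using edge_start_eq[OF K(1) u0] lexmax_convex_hull X(2) by blast
  ultimately have a: "a \<in> X" "\<And>x. x \<in> X \<Longrightarrow> lexnn u (- rot u) (a - x)"
    by (auto simp: lexmax_def)
  obtain b where "lexmax u (rot u) X b"
    using lexmax_exists[OF X(1) \<open>X \<noteq> {}\<close>] by blast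
  moreover from this have b_eq: "edge_end K u = b"
    using edge_end_eq[OF K(1) u0] lexmax_convex_hull X(2) by blast
  ultimately have b: "b \<in> X" "\<And>x. x \<in> X \<Longrightarrow> lexnn u (rot u) (b - x)"
    by (auto simp: lexmax_def)
  have ev_pos: "\<forall>\<^sub>F w in nhds u. w \<bullet> z > 0" if "u \<bullet> z > 0" for z
  proof -
    have "((\<lambda>w. w \<bullet> z) \<longlongrightarrow> u \<bullet> z) (nhds u)"
      by (intro tendsto_intros filterlim_ident)
    then show ?thesis
      using that by (rule order_tendstoD)
  qed
  have "\<forall>\<^sub>F w in nhds u. \<forall>x\<in>X. (u \<bullet> (a - x) > 0 \<longrightarrow> w \<bullet> (a - x) > 0) \<and> (u \<bullet> (b - x) > 0 \<longrightarrow> w \<bullet> (b - x) > 0)"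
    using X(1) ev_pos by (intro eventually_ball_finite ballI eventually_conj) (auto simp: eventually_mono)
  \<comment> \<open>This keeps \<open>w\<close> nonzero. When \<open>rot u \<bullet> w = 0\<close>
    it also makes \<open>w\<close> a positive multiple of \<open>u\<close>, so the tie-break at
    \<open>w\<close> agrees with the one at \<open>u\<close>.\<close>
  moreover have "\<forall>\<^sub>F w in nhds u. w \<bullet> u > 0"
    using u0 by (intro ev_pos) simp
  ultimately show ?thesis
  proof eventually_elim
    case (elim w)
    have w0: "w \<noteq> 0" using elim(2) by auto
    show ?case
    proof (cases "rot u \<bullet> w > 0")
      case True
      have "lexnn w (- rot w) (b - x)" if x: "x \<in> X" for x
      proof (cases "u \<bullet> (b - x) = 0")
        case True
        define t where "t = (rot u \<bullet> (b - x)) / (u \<bullet> u)"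
        have eq: "b - x = t *\<^sub>R rot u"
          unfolding t_def using True by (rule orthogonal_imp_scaleR_rot[OF u0])
        have "t \<ge> 0"
          using b(2)[OF x] True by (simp add: lexnn_def t_def)
        then show ?thesis
          using \<open>rot u \<bullet> w > 0\<close> unfolding eq
          by (cases "t = 0") (auto simp: lexnn_def inner_commute)
      next
        case False
        then show ?thesis
          using b(2)[OF x] elim(1) x by (auto simp: lexnn_def)
      qed
      then have "lexmax w (- rot w) X b"
        using b(1) by (auto simp: lexmax_def)
      then show ?thesis
        using edge_start_eq[OF K(1) w0] lexmax_convex_hull X(2) b_eq True by auto
    next
      case False
      have "lexnn w (- rot w) (a - x)" if x: "x \<in> X" for x
      proof (cases "u \<bullet> (a - x) = 0")
        case True
        define t where "t = (rot u \<bullet> (a - x)) / (u \<bullet> u)"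
        have eq: "a - x = t *\<^sub>R rot u"
          unfolding t_def using True by (rule orthogonal_imp_scaleR_rot[OF u0])
        have "t \<le> 0"
          using a(2)[OF x] True by (simp add: lexnn_def t_def divide_nonpos_nonneg)
        show ?thesis
        proof (cases "t = 0 \<or> rot u \<bullet> w < 0")
          case True
          then show ?thesis
            using \<open>t \<le> 0\<close> unfolding eq
            by (cases "t = 0") (auto simp: lexnn_def inner_commute mult_neg_neg)
        next
          case False
          then have "rot u \<bullet> w = 0"
            using \<open>\<not> rot u \<bullet> w > 0\<close> by simp
          then show ?thesis
            using \<open>t \<le> 0\<close> elim(2) unfolding eq
            by (auto simp: lexnn_def inner_commute mult_nonpos_nonneg)
        qed
      next
        case False
        then show ?thesis
          using a(2)[OF x] elim(1) x by (auto simp: lexnn_def)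
      qed
      then have "lexmax w (- rot w) X a"
        using a(1) by (auto simp: lexmax_def)
      then show ?thesis
        using edge_start_eq[OF K(1) w0] lexmax_convex_hull X(2) a_eq False by auto
    qed
  qed
qed

section \<open>Reconstruction of a polygon from its edge vectors\<close>

definition edge_vectors :: "(real \<times> real) set \<Rightarrow> (real \<times> real) set" where
  "edge_vectors K = {q - p | p q. ccw_edge K p q}"

text \<open>An edge vector determines its outer normal up to a positive factor, and the maxima for
  that normal are unique. So at most one edge has a given direction, and the bare set of edge
  vectors fixes the length of every face.\<close>

lemma edge_vector_direction:
  assumes K: "polytope K" "K \<noteq> {}" and u0: "u \<noteq> 0" and t: "t > 0" "t *\<^sub>R rot u \<in> edge_vectors K"
  shows "edge_end K u - edge_start K u = t *\<^sub>R rot u"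
proof -
  obtain p q where pq: "ccw_edge K p q" "t *\<^sub>R rot u = q - p"
    using t by (auto simp: edge_vectors_def)
  have *: "- rot (q - p) = t *\<^sub>R u"
    by (simp add: pq(2)[symmetric])
  have "lexmax (t *\<^sub>R u) (t *\<^sub>R - rot u) K p" "lexmax (t *\<^sub>R u) (t *\<^sub>R rot u) K q"
    using ccw_edge_imp_lexmax(2,3)[OF pq(1)] unfolding * by simp_all
  then have "lexmax u (- rot u) K p" "lexmax u (rot u) K q"
    by (simp_all only: lexmax_pos_multiple[OF t(1) t(1)])
  then show ?thesis
    using edge_start_eq[OF K(1) u0] edge_end_eq[OF K(1) u0] pq(2) by simp
qed

text \<open>Stated with an inclusion so that it can be applied in both roles: a direction in which
  one polygon has only a vertex is settled by exchanging the polygons.\<close>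

lemma edge_vectors_determine_diff:
  assumes K: "polytope K" "K \<noteq> {}" and L: "polytope L" "L \<noteq> {}"
    and sub: "edge_vectors K \<subseteq> edge_vectors L" and u0: "u \<noteq> 0" and ne: "edge_end K u \<noteq> edge_start K u"
  shows "edge_end L u - edge_start L u = edge_end K u - edge_start K u"
proof -
  obtain t where t: "t \<ge> 0" "edge_end K u - edge_start K u = t *\<^sub>R rot u"
    using lexmax_diff[OF u0 lexmax_edge_start[OF K] lexmax_edge_end[OF K]] .
  then have "t > 0"
    using ne by (cases "t = 0") auto
  moreover have "t *\<^sub>R rot u \<in> edge_vectors L"
  proof -
    have "ccw_edge K (edge_start K u) (edge_end K u)"
      using lexmax_imp_ccw_edge[OF polytope_imp_convex[OF K(1)] u0 lexmax_edge_start[OF K] lexmax_edge_end[OF K]] ne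
      by simp
    then have "edge_end K u - edge_start K u \<in> edge_vectors K"
      unfolding edge_vectors_def by blast
    then show ?thesis
      using sub t(2) by auto
  qed
  ultimately show ?thesis
    using edge_vector_direction[OF L u0] t(2) by simp
qed

lemma edge_vectors_eq_diff:
  assumes K: "polytope K" "K \<noteq> {}" and L: "polytope L" "L \<noteq> {}"
    and eq: "edge_vectors K = edge_vectors L" and u0: "u \<noteq> 0"
  shows "edge_end L u - edge_start L u = edge_end K u - edge_start K u"
proof (cases "edge_end K u = edge_start K u")
  case True
  then show ?thesis
    using edge_vectors_determine_diff[OF L K _ u0] eq by fastforce
qed (use edge_vectors_determine_diff[OF K L _ u0] eq in auto)

text \<open>
  Turning \<open>u\<close> past the outer normal of an edge moves the extreme vertex along that edge, by the same
  vector for both polygons. So the offset between the extreme vertices is a locally constant function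
  of \<open>u\<close> on the punctured plane.
\<close>

lemma edge_start_offset:
  assumes K: "polytope K" "K \<noteq> {}" and L: "polytope L" "L \<noteq> {}"
    and eq: "edge_vectors K = edge_vectors L"
  obtains d where "\<And>u. u \<noteq> 0 \<Longrightarrow> edge_start L u = edge_start K u + d"
proof -
  have "connected (- {0 :: real \<times> real})"
    by (rule connected_punctured_universe) simp
  moreover have "\<forall>\<^sub>F w in nhds u. edge_start L u - edge_start K u = edge_start L w - edge_start K w"
    if "u \<noteq> 0" for u
    using edge_start_rotate[OF K that] edge_start_rotate[OF L that]
  proof eventually_elim
    case (elim w)
    then show ?case
      using edge_vectors_eq_diff[OF K L eq that] by (auto simp: algebra_simps)
  qed
  then have "\<forall>u\<in>- {0}. \<forall>\<^sub>F w in at u within - {0}. edge_start L u - edge_start K u = edge_start L w - edge_start K w"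
    unfolding eventually_at_filter by (auto intro: eventually_mono simp del: split_paired_All)
  ultimately have *: "\<And>u v. u \<noteq> 0 \<Longrightarrow> v \<noteq> 0 \<Longrightarrow>
      edge_start L u - edge_start K u = edge_start L v - edge_start K v"
    by (intro connected_local_const[where f = "\<lambda>w. edge_start L w - edge_start K w"]) auto
  have "edge_start L u = edge_start K u + (edge_start L (1, 0) - edge_start K (1, 0))" if "u \<noteq> 0" for u
    using *[OF that, of "(1, 0)"] by (simp add: zero_prod_def algebra_simps)
  then show ?thesis
    by (rule that)
qed

lemma mem_closed_convex_iff_support:
  fixes z :: "'a :: euclidean_space"
  assumes K: "convex K" "closed K" and h: "\<And>u. u \<noteq> 0 \<Longrightarrow> \<exists>a\<in>K. u \<bullet> a = h u \<and> (\<forall>z\<in>K. u \<bullet> z \<le> h u)"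
  shows "z \<in> K \<longleftrightarrow> (\<forall>u. u \<noteq> 0 \<longrightarrow> u \<bullet> z \<le> h u)"
proof
  assume *: "\<forall>u. u \<noteq> 0 \<longrightarrow> u \<bullet> z \<le> h u"
  show "z \<in> K"
  proof (rule ccontr)
    assume "z \<notin> K"
    then obtain a b where ab: "a \<bullet> z < b" "\<forall>x\<in>K. a \<bullet> x > b"
      using separating_hyperplane_closed_point[OF K] by blast
    show False
    proof (cases "a = 0")
      \<comment> \<open>With \<open>a = 0\<close> the separation says 0 < b and, at any point of
        \<open>K\<close>, b < 0. Such a point exists because the support value in direction
        \<open>e\<close> is attained.\<close>
      case True
      obtain e :: 'a where "e \<in> Basis" using nonempty_Basis by blast
      then have "e \<noteq> 0" by auto
      then show False
        using h[of e] ab True by auto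
    next
      case False
      then obtain x where "x \<in> K" "(- a) \<bullet> x = h (- a)"
        using h[of "- a"] by auto
      then show False
        using ab(1) ab(2)[rule_format, of x] *[rule_format, of "- a"] False by simp
    qed
  qed
qed (use h in blast)

text \<open>A constant offset \<open>d\<close> of the extreme vertices shifts the support value in
  direction \<open>u\<close> by \<open>u \<bullet> d\<close>, and a closed convex set is determined
  by its support values.\<close>

lemma edge_vectors_unique:
  assumes K: "polytope K" "K \<noteq> {}" and L: "polytope L" "L \<noteq> {}"
    and eq: "edge_vectors K = edge_vectors L"
  obtains d where "L = (\<lambda>z. z + d) ` K"
proof -
  obtain d where d: "\<And>u. u \<noteq> 0 \<Longrightarrow> edge_start L u = edge_start K u + d"
    using edge_start_offset[OF K L eq] by blast
  have mem: "z \<in> M \<longleftrightarrow> (\<forall>u. u \<noteq> 0 \<longrightarrow> u \<bullet> z \<le> u \<bullet> edge_start M u)" if "polytope M" "M \<noteq> {}" for M z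
  proof (intro mem_closed_convex_iff_support polytope_imp_convex polytope_imp_closed that)
    fix u
    have "edge_start M u \<in> M"
      using lexmax_edge_start[OF that, of u] by (simp add: lexmax_def)
    then show "\<exists>a\<in>M. u \<bullet> a = u \<bullet> edge_start M u \<and> (\<forall>z\<in>M. u \<bullet> z \<le> u \<bullet> edge_start M u)"
      using lexmax_inner_le[OF lexmax_edge_start[OF that, of u]] by blast
  qed
  have iff: "z + d \<in> L \<longleftrightarrow> z \<in> K" for z
    using mem[OF K, of z] mem[OF L, of "z + d"] d by (auto simp: inner_add_right)
  then have "L = (\<lambda>z. z + d) ` K"
    using iff[of "_ - d"] by (auto simp: iff intro!: image_eqI[where x = "_ - d"] simp del: split_paired_All)
  then show ?thesis
    by (rule that)
qed

section \<open>Zonotopes\<close>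

text \<open>The Minkowski sum of the segments from 0 to v/2, written as a hull of subset sums so
  that extreme points can be chosen summand by summand. The factor 1/2 compensates for
  \<open>W\<close> containing both v and -v: each supplies half of the edge v. The same symmetry
  centers the set at the origin.\<close>

definition zonotope :: "(real \<times> real) set \<Rightarrow> (real \<times> real) set" where
  "zonotope W = convex hull ((\<lambda>A. (1 / 2) *\<^sub>R \<Sum>A) ` Pow W)"

text \<open>The support function of \<open>zonotope W\<close> for symmetric finite \<open>W\<close>:
  the best half subset sum collects half of the positive parts of \<open>u \<bullet> v\<close>, and
  by symmetry these make up half of the sum of absolute values.\<close>

definition abs_support :: "(real \<times> real) set \<Rightarrow> real \<times> real \<Rightarrow> real" where
  "abs_support W u = (\<Sum>v\<in>W. \<bar>u \<bullet> v\<bar>) / 4"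

lemma polytope_zonotope: "finite W \<Longrightarrow> polytope (zonotope W)"
  by (auto simp: polytope_def zonotope_def intro!: exI[of _ "(\<lambda>A. (1 / 2) *\<^sub>R \<Sum>A) ` Pow W"])

lemma zonotope_nonempty: "zonotope W \<noteq> {}"
  by (auto simp: zonotope_def)

text \<open>Each vector enters a subset sum independently of the others, so taking exactly the
  favorable ones is optimal.\<close>

lemma lexmax_zonotope:
  assumes W: "finite W"
    and P: "\<And>v. v \<in> W \<Longrightarrow> P v \<Longrightarrow> lexnn u w v" "\<And>v. v \<in> W \<Longrightarrow> \<not> P v \<Longrightarrow> lexnn u w (- v)"
  shows "lexmax u w (zonotope W) ((1 / 2) *\<^sub>R \<Sum>{v \<in> W. P v})"
  unfolding zonotope_def
proof (rule lexmax_convex_hull)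
  have "lexnn u w ((1 / 2) *\<^sub>R \<Sum>{v \<in> W. P v} - (1 / 2) *\<^sub>R \<Sum>A)" if A: "A \<subseteq> W" for A
  proof -
    have "\<Sum>A = (\<Sum>v\<in>W. if v \<in> A then v else 0)"
      using W A by (simp add: sum.If_cases Int_absorb1)
    moreover have "\<Sum>{v \<in> W. P v} = (\<Sum>v\<in>W. if P v then v else 0)"
      using W by (rule sum.inter_filter)
    ultimately have "(1 / 2) *\<^sub>R \<Sum>{v \<in> W. P v} - (1 / 2) *\<^sub>R \<Sum>A =
        (1 / 2) *\<^sub>R (\<Sum>v\<in>W. (if P v then v else 0) - (if v \<in> A then v else 0))"
      by (simp only: sum_subtractf scaleR_right_diff_distrib)
    moreover have "lexnn u w \<dots>"
      by (intro lexnn_scaleR lexnn_sum) (auto simp: P)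
    ultimately show ?thesis by simp
  qed
  then show "lexmax u w ((\<lambda>A. (1 / 2) *\<^sub>R \<Sum>A) ` Pow W) ((1 / 2) *\<^sub>R \<Sum>{v \<in> W. P v})"
    by (auto simp: lexmax_def)
qed

lemma lexmax_zonotope_start:
  assumes "finite W"
  shows "lexmax u (- rot u) (zonotope W) ((1 / 2) *\<^sub>R \<Sum>{v \<in> W. u \<bullet> v > 0 \<or> (u \<bullet> v = 0 \<and> rot u \<bullet> v < 0)})"
  using assms by (rule lexmax_zonotope) (auto simp: lexnn_def)

lemma lexmax_zonotope_end:
  assumes "finite W"
  shows "lexmax u (rot u) (zonotope W) ((1 / 2) *\<^sub>R \<Sum>{v \<in> W. u \<bullet> v > 0 \<or> (u \<bullet> v = 0 \<and> rot u \<bullet> v > 0)})"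
  using assms by (rule lexmax_zonotope) (auto simp: lexnn_def)

text \<open>The two extreme sums share the vectors with \<open>u \<bullet> v > 0\<close> and differ
  only in those orthogonal to \<open>u\<close>. Those at the start are the negatives of those at the
  end, which turns the half difference into a full sum.\<close>

lemma zonotope_edge_diff:
  assumes W: "finite W" "\<And>v. v \<in> W \<Longrightarrow> - v \<in> W"
    and u0: "u \<noteq> 0" and a: "lexmax u (- rot u) (zonotope W) a" and b: "lexmax u (rot u) (zonotope W) b"
  shows "b - a = \<Sum>{v \<in> W. u \<bullet> v = 0 \<and> rot u \<bullet> v > 0}"
proof -
  let ?P = "{v \<in> W. u \<bullet> v > 0}" and ?E = "{v \<in> W. u \<bullet> v = 0 \<and> rot u \<bullet> v > 0}"
    and ?S = "{v \<in> W. u \<bullet> v = 0 \<and> rot u \<bullet> v < 0}"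
  have "{v \<in> W. u \<bullet> v > 0 \<or> (u \<bullet> v = 0 \<and> rot u \<bullet> v < 0)} = ?P \<union> ?S"
    "{v \<in> W. u \<bullet> v > 0 \<or> (u \<bullet> v = 0 \<and> rot u \<bullet> v > 0)} = ?P \<union> ?E"
    by auto
  moreover have "a = (1 / 2) *\<^sub>R \<Sum>{v \<in> W. u \<bullet> v > 0 \<or> (u \<bullet> v = 0 \<and> rot u \<bullet> v < 0)}"
    using lexmax_unique[OF u0 _ a lexmax_zonotope_start[OF W(1)]] by simp
  moreover have "b = (1 / 2) *\<^sub>R \<Sum>{v \<in> W. u \<bullet> v > 0 \<or> (u \<bullet> v = 0 \<and> rot u \<bullet> v > 0)}"
    using lexmax_unique[OF u0 _ b lexmax_zonotope_end[OF W(1)]] by simp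
  moreover have "\<Sum>(?P \<union> ?S) = \<Sum>?P + \<Sum>?S" "\<Sum>(?P \<union> ?E) = \<Sum>?P + \<Sum>?E"
    using W(1) by (auto intro!: sum.union_disjoint)
  moreover have "\<Sum>?S = - \<Sum>?E"
    unfolding sum_negf[symmetric]
    by (rule sum.reindex_bij_witness[of _ uminus uminus]) (auto simp: W(2))
  ultimately have "b - a = (1 / 2) *\<^sub>R (\<Sum>?E + \<Sum>?E)"
    by (simp add: algebra_simps)
  then show ?thesis
    by (simp flip: scaleR_2)
qed

text \<open>An edge is the sum of all vectors of \<open>W\<close> on one ray. The hypothesis
  \<open>ray\<close> leaves a single one there, so no two vectors merge into a longer edge.\<close>

lemma edge_vectors_zonotope:
  assumes W: "finite W" "\<And>v. v \<in> W \<Longrightarrow> - v \<in> W" "0 \<notin> W"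
    and ray: "\<And>v c. v \<in> W \<Longrightarrow> c > 0 \<Longrightarrow> c *\<^sub>R v \<in> W \<Longrightarrow> c = 1"
  shows "edge_vectors (zonotope W) = W"
proof -
  have on_ray: "{v \<in> W. u \<bullet> v = 0 \<and> rot u \<bullet> v > 0} = {v0}"
    if u0: "u \<noteq> 0" and v0: "v0 \<in> W" "u \<bullet> v0 = 0" "rot u \<bullet> v0 > 0" for u v0
  proof -
    have "v = v0" if v: "v \<in> W" "u \<bullet> v = 0" "rot u \<bullet> v > 0" for v
    proof -
      define c where "c = (rot u \<bullet> v) / (rot u \<bullet> v0)"
      have c: "c > 0" using v0 v by (simp add: c_def)
      have "v = ((rot u \<bullet> v) / (u \<bullet> u)) *\<^sub>R rot u" "v0 = ((rot u \<bullet> v0) / (u \<bullet> u)) *\<^sub>R rot u"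
        using orthogonal_imp_scaleR_rot[OF u0] v0 v by blast+
      then have "v = c *\<^sub>R v0"
        using v0(3) by (metis c_def nonzero_eq_divide_eq less_irrefl scaleR_scaleR times_divide_eq_right)
      then show ?thesis
        using ray[OF v0(1) c] v(1) by simp
    qed
    then show ?thesis using v0 by blast
  qed
  note Z = polytope_zonotope[OF W(1)] zonotope_nonempty[of W]
  show ?thesis
  proof (intro equalityI subsetI)
    fix x assume "x \<in> edge_vectors (zonotope W)"
    then obtain p q where x: "x = q - p" and e: "ccw_edge (zonotope W) p q"
      by (auto simp: edge_vectors_def)
    define u where "u = - rot (q - p)"
    have u0: "u \<noteq> 0"
      using ccw_edge_imp_lexmax(1)[OF e] by (simp add: u_def)
    have "lexmax u (- rot u) (zonotope W) p" "lexmax u (rot u) (zonotope W) q"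
      using ccw_edge_imp_lexmax(2,3)[OF e] by (simp_all only: u_def)
    then have qp: "q - p = \<Sum>{v \<in> W. u \<bullet> v = 0 \<and> rot u \<bullet> v > 0}"
      using zonotope_edge_diff[OF W(1,2) u0] by blast
    then have "{v \<in> W. u \<bullet> v = 0 \<and> rot u \<bullet> v > 0} \<noteq> {}"
      using ccw_edge_imp_lexmax(1)[OF e] by (metis eq_iff_diff_eq_0 sum.empty)
    then obtain v0 where v0: "v0 \<in> W" "u \<bullet> v0 = 0" "rot u \<bullet> v0 > 0"
      by blast
    then have "q - p = v0"
      using qp on_ray[OF u0 v0] by simp
    then show "x \<in> W" using v0 x by simp
  next
    fix v0 assume v0: "v0 \<in> W"
    define u where "u = - rot v0"
    have "v0 \<noteq> 0" using v0 W(3) by auto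
    then have u0: "u \<noteq> 0" and ru: "rot u = v0" by (simp_all add: u_def)
    let ?a = "edge_start (zonotope W) u" and ?b = "edge_end (zonotope W) u"
    have ab: "?b - ?a = v0"
      using zonotope_edge_diff[OF W(1,2) u0 lexmax_edge_start[OF Z] lexmax_edge_end[OF Z]]
        on_ray[OF u0 v0] \<open>v0 \<noteq> 0\<close> by (simp add: ru inner_rot_self(1)[of u, unfolded ru])
    then have "ccw_edge (zonotope W) ?a ?b"
      using lexmax_imp_ccw_edge[OF polytope_imp_convex[OF Z(1)] u0 lexmax_edge_start[OF Z] lexmax_edge_end[OF Z]] \<open>v0 \<noteq> 0\<close>
      by auto
    then show "v0 \<in> edge_vectors (zonotope W)"
      unfolding edge_vectors_def using ab by blast
  qed
qed

lemma zonotope_support: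
  assumes W: "finite W" "\<And>v. v \<in> W \<Longrightarrow> - v \<in> W"
  shows "\<exists>a\<in>zonotope W. u \<bullet> a = abs_support W u \<and> (\<forall>z\<in>zonotope W. u \<bullet> z \<le> abs_support W u)"
proof -
  let ?P = "\<lambda>v. u \<bullet> v > 0 \<or> (u \<bullet> v = 0 \<and> rot u \<bullet> v > 0)"
  have sum0: "(\<Sum>v\<in>W. u \<bullet> v) = 0"
  proof -
    have "(\<Sum>v\<in>W. u \<bullet> v) = (\<Sum>v\<in>W. - (u \<bullet> v))"
      by (rule sum.reindex_bij_witness[of _ uminus uminus]) (auto simp: W(2))
    then show ?thesis by (simp add: sum_negf)
  qed
  have "u \<bullet> ((1 / 2) *\<^sub>R \<Sum>{v \<in> W. ?P v}) = (1 / 2) * (\<Sum>v\<in>{v \<in> W. ?P v}. u \<bullet> v)"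
    by (simp add: inner_sum_right)
  also have "(\<Sum>v\<in>{v \<in> W. ?P v}. u \<bullet> v) = (\<Sum>v\<in>W. if ?P v then u \<bullet> v else 0)"
    using W(1) by (rule sum.inter_filter)
  also have "\<dots> = (\<Sum>v\<in>W. (1 / 2) * \<bar>u \<bullet> v\<bar> + (1 / 2) * (u \<bullet> v))"
    by (intro sum.cong) auto
  also have "\<dots> = (1 / 2) * (\<Sum>v\<in>W. \<bar>u \<bullet> v\<bar>)"
    using sum0 by (simp add: sum.distrib flip: sum_divide_distrib)
  finally have eq: "u \<bullet> ((1 / 2) *\<^sub>R \<Sum>{v \<in> W. ?P v}) = abs_support W u"
    by (simp add: abs_support_def)
  have "(1 / 2) *\<^sub>R \<Sum>{v \<in> W. ?P v} \<in> zonotope W"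
    using lexmax_zonotope_end[OF W(1), of u] unfolding lexmax_def by blast
  moreover have "\<forall>z\<in>zonotope W. u \<bullet> z \<le> abs_support W u"
    using lexmax_inner_le[OF lexmax_zonotope_end[OF W(1), of u]] unfolding eq by blast
  ultimately show ?thesis
    using eq by blast
qed

lemma mem_zonotope_iff:
  assumes W: "finite W" "\<And>v. v \<in> W \<Longrightarrow> - v \<in> W"
  shows "z \<in> zonotope W \<longleftrightarrow> (\<forall>u. u \<noteq> 0 \<longrightarrow> u \<bullet> z \<le> abs_support W u)"
  using polytope_zonotope[OF W(1)] zonotope_support[OF W]
  by (intro mem_closed_convex_iff_support polytope_imp_convex polytope_imp_closed)

section \<open>Symmetry, center and scale\<close>

lemma abs_support_symmetric:
  assumes "dihedral_symmetric W"
  shows "abs_support W (- x, y) = abs_support W (x, y)" "abs_support W (x, - y) = abs_support W (x, y)"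
    "abs_support W (y, x) = abs_support W (x, y)"
proof -
  have sym: "(- a, b) \<in> W \<and> (a, - b) \<in> W \<and> (b, a) \<in> W" if "(a, b) \<in> W" for a b
    using assms that by (auto simp: dihedral_symmetric_def)
  show "abs_support W (- x, y) = abs_support W (x, y)"
    unfolding abs_support_def
    by (intro arg_cong[where f = "\<lambda>t. t / 4"] sum.reindex_bij_witness[of _ "\<lambda>(a, b). (- a, b)" "\<lambda>(a, b). (- a, b)"])
       (auto simp: sym)
  show "abs_support W (x, - y) = abs_support W (x, y)"
    unfolding abs_support_def
    by (intro arg_cong[where f = "\<lambda>t. t / 4"] sum.reindex_bij_witness[of _ "\<lambda>(a, b). (a, - b)" "\<lambda>(a, b). (a, - b)"])
       (auto simp: sym)
  show "abs_support W (y, x) = abs_support W (x, y)"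
    unfolding abs_support_def
    by (intro arg_cong[where f = "\<lambda>t. t / 4"] sum.reindex_bij_witness[of _ "\<lambda>(a, b). (b, a)" "\<lambda>(a, b). (b, a)"])
       (auto simp: sym add.commute)
qed

lemma dihedral_symmetric_uminus: "dihedral_symmetric W \<Longrightarrow> v \<in> W \<Longrightarrow> - v \<in> W"
  by (cases v) (auto simp: dihedral_symmetric_def)

lemma dihedral_symmetric_zonotope:
  assumes W: "finite W" "dihedral_symmetric W"
  shows "dihedral_symmetric (zonotope W)"
proof -
  have mem: "z \<in> zonotope W \<longleftrightarrow> (\<forall>u. u \<noteq> 0 \<longrightarrow> u \<bullet> z \<le> abs_support W u)" for z
    by (rule mem_zonotope_iff[OF W(1)]) (rule dihedral_symmetric_uminus[OF W(2)])
  have "(- x, y) \<in> zonotope W \<and> (x, - y) \<in> zonotope W \<and> (y, x) \<in> zonotope W"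
    if "(x, y) \<in> zonotope W" for x y
  proof -
    have *: "u \<bullet> (x, y) \<le> abs_support W u" if "u \<noteq> 0" for u
      using mem[THEN iffD1, rule_format, OF \<open>(x, y) \<in> zonotope W\<close>] that by blast
    have "u \<bullet> (- x, y) \<le> abs_support W u \<and> u \<bullet> (x, - y) \<le> abs_support W u \<and> u \<bullet> (y, x) \<le> abs_support W u"
      if u: "u \<noteq> 0" for u
    proof -
      obtain s t where st: "u = (s, t)" by (cases u)
      have "(- s, t) \<noteq> 0" "(s, - t) \<noteq> 0" "(t, s) \<noteq> 0"
        using u by (auto simp: st zero_prod_def)
      then have "(- s, t) \<bullet> (x, y) \<le> abs_support W (- s, t)" "(s, - t) \<bullet> (x, y) \<le> abs_support W (s, - t)"
        "(t, s) \<bullet> (x, y) \<le> abs_support W (t, s)"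
        using * by blast+
      then show ?thesis
        by (simp add: st abs_support_symmetric[OF W(2)] add.commute)
    qed
    then show ?thesis
      by (simp add: mem)
  qed
  then show ?thesis
    by (auto simp: dihedral_symmetric_def)
qed

text \<open>Two centers of symmetry at distance \<open>f\<close> would make the set invariant under
  translation by 2f, impossible for a bounded set: the farthest point in direction \<open>f\<close>
  could be pushed further. This makes the center of the polygon unique.\<close>

lemma symmetric_translate_imp_zero:
  fixes Z :: "'a :: real_inner set"
  assumes Z: "compact Z" "Z \<noteq> {}" "\<And>z. z \<in> Z \<Longrightarrow> - z \<in> Z"
    and f: "\<And>z. z \<in> (\<lambda>z. z + f) ` Z \<Longrightarrow> - z \<in> (\<lambda>z. z + f) ` Z"
  shows "f = 0"
proof -
  have "continuous_on Z (\<lambda>z. f \<bullet> z)"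
    by (intro continuous_intros)
  then obtain a where a: "a \<in> Z" "\<And>z. z \<in> Z \<Longrightarrow> f \<bullet> z \<le> f \<bullet> a"
    using continuous_attains_sup[OF Z(1,2), of "\<lambda>z. f \<bullet> z"] by blast
  have "- (a + f) \<in> (\<lambda>z. z + f) ` Z"
    using f a(1) by blast
  then obtain z where "z \<in> Z" "- (a + f) = z + f" by blast
  then have "a + f + f \<in> Z"
    using Z(3)[of z] by (metis add.commute add_diff_cancel_left' add_uminus_conv_diff minus_diff_eq uminus_add_conv_diff)
  then have "f \<bullet> f \<le> 0"
    using a(2)[of "a + f + f"] by (simp add: inner_add_right)
  then show ?thesis by (metis inner_gt_zero_iff not_le)
qed

lemma is_jarnik_polygon_iff_edge_vectors: "is_jarnik_polygon Q S K \<longleftrightarrow> polytope K \<and> edge_vectors K = V Q S"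
  by (simp add: is_jarnik_polygon_def edge_vectors_def)

text \<open>This evaluates the definite description: left to right is uniqueness, right to left
  existence, with the zonotope as \<open>K\<close>, center 0 and scale
  \<open>1 / abs_support W (0, 1)\<close>.\<close>

lemma is_scaled_jarnik_polygon_iff:
  assumes W: "W = V Q S" "finite W" "dihedral_symmetric W" "(1, 0) \<in> W" "0 \<notin> W"
    and ray: "\<And>v c. v \<in> W \<Longrightarrow> c > 0 \<Longrightarrow> c *\<^sub>R v \<in> W \<Longrightarrow> c = 1"
  shows "is_scaled_jarnik_polygon Q S P \<longleftrightarrow>
    P = (\<lambda>z. (1 / abs_support W (0, 1)) *\<^sub>R z) ` frontier (zonotope W)"
proof -
  define Z where "Z = zonotope W"
  define H where "H = abs_support W (0, 1)"
  note neg = dihedral_symmetric_uminus[OF W(3)]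
  have Z: "polytope Z" "Z \<noteq> {}"
    by (simp_all add: Z_def polytope_zonotope W(2) zonotope_nonempty)
  have EZ: "edge_vectors Z = W"
    unfolding Z_def by (rule edge_vectors_zonotope[OF W(2) neg W(5) ray])
  have symZ: "dihedral_symmetric Z"
    unfolding Z_def by (rule dihedral_symmetric_zonotope[OF W(2,3)])
  \<comment> \<open>The outer normal of the counterclockwise edge (1, 0), so that the normalization
    concerns the bottom of the polygon.\<close>
  let ?u = "(0, - 1) :: real \<times> real"
  have u0: "?u \<noteq> 0" and ru: "rot ?u = (1, 0)"
    by (simp_all add: zero_prod_def rot_def)
  obtain m where m: "m \<in> Z" "?u \<bullet> m = H" "\<And>z. z \<in> Z \<Longrightarrow> ?u \<bullet> z \<le> H"
    using zonotope_support[OF W(2) neg, of ?u] abs_support_symmetric(2)[OF W(3), of 0 1]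
    unfolding Z_def H_def by auto
  have "(0, 1) \<in> W"
    using W(3,4) by (auto simp: dihedral_symmetric_def)
  then have "\<bar>(0, 1) \<bullet> (0 :: real, 1 :: real)\<bar> \<le> (\<Sum>v\<in>W. \<bar>(0, 1) \<bullet> v\<bar>)"
    using W(2) by (intro member_le_sum[of _ _ "\<lambda>v. \<bar>(0, 1) \<bullet> v\<bar>"]) auto
  then have H: "H > 0"
    by (simp add: H_def abs_support_def)
  have "P = (\<lambda>z. (1 / H) *\<^sub>R z) ` frontier Z" if P: "is_scaled_jarnik_polygon Q S P"
  proof -
    obtain K c s p q where K: "polytope K" "edge_vectors K = W"
      and sym: "dihedral_symmetric ((\<lambda>z. z - c) ` K)" and s: "s > 0"
      and e: "ccw_edge K p q" "q - p = (1, 0)" and mid: "s *\<^sub>R (midpoint p q - c) = (0, - 1)"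
      and P_eq: "P = (\<lambda>z. s *\<^sub>R (z - c)) ` frontier K"
      using P unfolding is_scaled_jarnik_polygon_def is_jarnik_polygon_iff_edge_vectors W(1)[symmetric] by blast
    have lp: "lexmax ?u (- rot ?u) K p"
      using ccw_edge_imp_lexmax(2)[OF e(1)] by (simp add: e(2) rot_def)
    then have "p \<in> K" by (simp add: lexmax_def)
    then have "K \<noteq> {}" by auto
    obtain d where d: "K = (\<lambda>z. z + d) ` Z"
      by (rule edge_vectors_unique[OF Z K(1) \<open>K \<noteq> {}\<close>]) (use EZ K(2) in auto)
    have shift: "(\<lambda>z. z - c) ` K = (\<lambda>z. z + (d - c)) ` Z"
      unfolding d image_image by (simp add: algebra_simps)
    have "d - c = 0"
      using sym[unfolded shift] symZ
      by (intro symmetric_translate_imp_zero[OF polytope_imp_compact[OF Z(1)] Z(2)] dihedral_symmetric_uminus)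
    then have KZ: "(\<lambda>z. z - c) ` K = Z"
      using shift by simp
    \<comment> \<open>Two inequalities fix the height of the bottom edge: \<open>p - c\<close> lies
      in \<open>Z\<close>, whose lowest height is \<open>- H\<close>, and \<open>m + c\<close> lies
      in \<open>K\<close>, where \<open>p\<close> is lowest.\<close>
    have "p - c \<in> Z"
      using \<open>p \<in> K\<close> KZ by blast
    then have "?u \<bullet> (p - c) \<le> H" by (rule m(3))
    moreover have "m + c \<in> K"
      using m(1) KZ by (auto simp: image_iff algebra_simps)
    then have "?u \<bullet> (m + c) \<le> ?u \<bullet> p"
      by (rule lexmax_inner_le[OF lp])
    ultimately have "snd (p - c) = - H"
      using m(2) by (simp add: inner_pair)
    moreover have "snd (midpoint p q) = snd p"
      using arg_cong[OF e(2), of snd] by (simp add: midpoint_def)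
    ultimately have "s * (- H) = - 1"
      using arg_cong[OF mid, of snd] by simp
    then have "s = 1 / H"
      using H by (simp add: field_simps)
    then have "P = (\<lambda>z. (1 / H) *\<^sub>R z) ` ((\<lambda>z. z - c) ` frontier K)"
      by (simp add: P_eq image_image)
    also have "(\<lambda>z. z - c) ` frontier K = frontier Z"
    proof -
      have minus: "(\<lambda>z. z - c) = (+) (- c)" by (simp add: fun_eq_iff)
      show ?thesis
        unfolding KZ[symmetric] minus by (rule frontier_translation[symmetric])
    qed
    finally show ?thesis .
  qed
  moreover have "is_scaled_jarnik_polygon Q S ((\<lambda>z. (1 / H) *\<^sub>R z) ` frontier Z)"
  proof -
    let ?p = "edge_start Z ?u" and ?q = "edge_end Z ?u"
    have qp: "?q - ?p = (1, 0)"
      using edge_vector_direction[OF Z u0, of 1] EZ W(4) by (simp add: ru)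
    have p: "lexmax ?u (- rot ?u) Z ?p" and q: "lexmax ?u (rot ?u) Z ?q"
      using lexmax_edge_start[OF Z] lexmax_edge_end[OF Z] by blast+
    have "?p \<noteq> ?q"
      using arg_cong[OF qp, of fst] by auto
    then have e: "ccw_edge Z ?p ?q"
      by (rule lexmax_imp_ccw_edge[OF polytope_imp_convex[OF Z(1)] u0 p q])
    \<comment> \<open>Reflection in the vertical axis exchanges the ends of the bottom edge, so its
      midpoint lies on that axis.\<close>
    have refl: "(- fst z, snd z) \<in> Z" if "z \<in> Z" for z
      using symZ that by (cases z) (auto simp: dihedral_symmetric_def)
    have "lexmax ?u (rot ?u) Z (- fst ?p, snd ?p)"
      unfolding lexmax_def
    proof (intro conjI ballI)
      show "(- fst ?p, snd ?p) \<in> Z"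
        using refl p by (simp add: lexmax_def)
      fix z assume "z \<in> Z"
      then have "lexnn ?u (- rot ?u) (?p - (- fst z, snd z))"
        using refl p by (simp add: lexmax_def)
      then show "lexnn ?u (rot ?u) ((- fst ?p, snd ?p) - z)"
        by (auto simp: lexnn_def inner_pair ru)
    qed
    then have q_eq: "?q = (- fst ?p, snd ?p)"
      using edge_end_eq[OF Z(1) u0] by blast
    have "?u \<bullet> ?p = H"
      using lexmax_inner_le[OF p m(1)] m(2) m(3)[of ?p] p by (simp add: lexmax_def)
    then have "snd ?p = - H" by (simp add: inner_pair)
    then have "(1 / H) *\<^sub>R (midpoint ?p ?q - 0) = (0, - 1)"
      using H by (subst q_eq) (simp add: midpoint_def prod_eq_iff)
    then show ?thesis
      unfolding is_scaled_jarnik_polygon_def is_jarnik_polygon_iff_edge_vectors W(1)[symmetric]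
      using Z(1) EZ symZ H e qp
      by (intro exI[of _ Z] exI[of _ 0] exI[of _ "1 / H"] conjI exI[of _ ?p] exI[of _ ?q]) simp_all
  qed
  ultimately show ?thesis
    unfolding Z_def H_def by blast
qed

lemma scaled_jarnik_polygon_eq:
  assumes "W = V Q S" "finite W" "dihedral_symmetric W" "(1, 0) \<in> W" "0 \<notin> W"
    "\<And>v c. v \<in> W \<Longrightarrow> c > 0 \<Longrightarrow> c *\<^sub>R v \<in> W \<Longrightarrow> c = 1"
  shows "scaled_jarnik_polygon Q S = (\<lambda>z. (1 / abs_support W (0, 1)) *\<^sub>R z) ` frontier (zonotope W)"
  unfolding scaled_jarnik_polygon_def
  by (rule the_equality) (simp_all only: is_scaled_jarnik_polygon_iff[OF assms])

text \<open>If every support inequality were strict at \<open>z\<close>, the gap would have a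
  positive minimum over the compact unit sphere, and a ball of that radius around \<open>z\<close>
  would lie in the zonotope.\<close>

lemma frontier_zonotope_support:
  assumes W: "finite W" "\<And>v. v \<in> W \<Longrightarrow> - v \<in> W" and z: "z \<in> frontier (zonotope W)"
  shows "\<And>u. u \<bullet> z \<le> abs_support W u" "\<exists>u. u \<noteq> 0 \<and> u \<bullet> z = abs_support W u"
proof -
  have "closed (zonotope W)"
    using polytope_zonotope[OF W(1)] by (rule polytope_imp_closed)
  then have zZ: "z \<in> zonotope W"
    using z by (auto simp: frontier_def)
  then show le: "u \<bullet> z \<le> abs_support W u" for u
    using zonotope_support[OF W, of u] by blast
  define g where "g u = abs_support W u - u \<bullet> z" for u
  have cont: "continuous_on (sphere 0 1) g"
    unfolding g_def abs_support_def by (intro continuous_intros) auto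
  have "(1, 0) \<in> sphere (0 :: real \<times> real) 1" by (simp add: norm_Pair)
  then have "sphere (0 :: real \<times> real) 1 \<noteq> {}" by blast
  then obtain u where u: "u \<in> sphere 0 1" "\<And>w. w \<in> sphere 0 1 \<Longrightarrow> g u \<le> g w"
    using continuous_attains_inf[OF compact_sphere _ cont] by blast
  have "g u \<le> 0"
  proof (rule ccontr)
    assume "\<not> g u \<le> 0"
    then have pos: "g u > 0" by simp
    have "ball z (g u) \<subseteq> zonotope W"
    proof
      fix y assume y: "y \<in> ball z (g u)"
      have "w \<bullet> y \<le> abs_support W w" if w: "w \<noteq> 0" for w
      proof -
        define w' where "w' = (1 / norm w) *\<^sub>R w"
        have w': "norm w' = 1" "w = norm w *\<^sub>R w'"
          using w by (simp_all add: w'_def)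
        have "w' \<bullet> (y - z) \<le> norm w' * norm (y - z)"
          by (rule norm_cauchy_schwarz)
        also have "\<dots> < g u"
          using y w' by (simp add: dist_norm norm_minus_commute)
        also have "g u \<le> g w'"
          using u(2) w' by simp
        finally have "w' \<bullet> y \<le> abs_support W w'"
          by (simp add: g_def inner_diff_right)
        moreover have "abs_support W (c *\<^sub>R w') = c * abs_support W w'" if "c \<ge> 0" for c
          using that by (simp add: abs_support_def abs_mult sum_distrib_left)
        ultimately show ?thesis
          by (subst (1 2) w'(2)) (simp add: mult_left_mono)
      qed
      then show "y \<in> zonotope W"
        by (simp add: mem_zonotope_iff[OF W])
    qed
    then have "z \<in> interior (zonotope W)"
      using pos by (auto simp: mem_interior)
    then show False
      using z by (simp add: frontier_def)
  qed
  then have "u \<bullet> z = abs_support W u"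
    using le[of u] by (simp add: g_def)
  moreover have "u \<noteq> 0" using u by auto
  ultimately show "\<exists>u. u \<noteq> 0 \<and> u \<bullet> z = abs_support W u" by blast
qed

section \<open>Sums over primitive lattice points\<close>

lemma sum_inverse_squares_le: "(\<Sum>d = 2..n. 1 / (real d)\<^sup>2) \<le> 3 / 4"
proof -
  \<comment> \<open>The slack 1/n lets the induction telescope. Equality at n = 2, that is 1/4 +
    1/2, is the origin of 3/4.\<close>
  have *: "(\<Sum>d = 2..n. 1 / (real d)\<^sup>2) \<le> 3 / 4 - 1 / real n" if "n \<ge> 2" for n
    using that
  proof (induction n rule: dec_induct)
    case base
    then show ?case by (simp add: numeral_2_eq_2)
  next
    case (step n)
    have "1 / (real (Suc n))\<^sup>2 \<le> 1 / (real n * real (Suc n))"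
      using step by (intro divide_left_mono) (auto simp: power2_eq_square)
    also have "\<dots> = 1 / real n - 1 / real (Suc n)"
      using step by (simp add: field_simps)
    finally show ?case
      using step by simp
  qed
  show ?thesis
  proof (cases "n \<ge> 2")
    case True
    then show ?thesis
      by (intro order_trans[OF *]) auto
  qed simp
qed

text \<open>The harmonic sum is o(n): all but boundedly many terms are at most \<eta>, and the
  others are at most 1. No logarithmic estimate is involved.\<close>

lemma sum_inverse_le:
  assumes "\<eta> > 0"
  obtains M where "M \<ge> 0" "\<And>n. (\<Sum>d = 2..n. 1 / real d) \<le> \<eta> * real n + M"
proof -
  obtain k :: nat where k: "1 / \<eta> < real k"
    using reals_Archimedean2 by blast
  have "1 / real d \<le> \<eta> + (if d < k then 1 else 0)" if "d \<ge> 2" for d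
  proof (cases "d < k")
    case True
    have "1 / real d \<le> 1" using that by simp
    then show ?thesis using True assms by simp
  next
    case False
    then have "1 / \<eta> \<le> real d" using k by linarith
    then show ?thesis using False assms that by (simp add: field_simps)
  qed
  then have "(\<Sum>d = 2..n. 1 / real d) \<le> (\<Sum>d = 2..n. \<eta> + (if d < k then 1 else 0))" for n
    by (intro sum_mono) auto
  also have "(\<Sum>d = 2..n. \<eta> + (if d < k then 1 else 0)) \<le> \<eta> * real n + real k" for n
  proof -
    have "(\<Sum>d = 2..n. if d < k then 1 else 0 :: real) = real (card ({2..n} \<inter> {d. d < k}))"
      by (simp add: sum.If_cases)
    also have "card ({2..n} \<inter> {d. d < k}) \<le> card {..<k}"
      by (intro card_mono) auto
    finally have "(\<Sum>d = 2..n. if d < k then 1 else 0 :: real) \<le> real k"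
      by simp
    moreover have "(\<Sum>d = 2..n. \<eta>) \<le> \<eta> * real n"
      using assms by (simp add: mult.commute)
    ultimately show ?thesis
      unfolding sum.distrib by linarith
  qed
  finally show ?thesis
    using that[of "real k"] by simp
qed

text \<open>Isolating the term d = 1 shows that this holds whenever the sum of
  \<open>d * D (n div d)\<close> over d from 1 to n is at most \<open>C * n^2\<close> in absolute
  value. That is the situation once the cubic main terms of two lattice sums have cancelled.\<close>

definition div_recursive_bound :: "real \<Rightarrow> (nat \<Rightarrow> real) \<Rightarrow> bool" where
  "div_recursive_bound C D \<longleftrightarrow>
     (\<forall>n. \<bar>D n\<bar> \<le> C * (real n)\<^sup>2 + (\<Sum>d = 2..n. real d * \<bar>D (n div d)\<bar>))"

text \<open>
  Applying the recursive bound once to an arbitrary cubic bound contracts its leading coefficient,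
  because \<open>\<Sum>\<^sub>d\<^sub>\<ge>\<^sub>2 1/d\<^sup>2 \<le> 3/4 < 1\<close>. This replaces Moebius inversion.
\<close>

lemma cubic_bound_contracts:
  assumes "C \<ge> 0" "\<beta> > 0" "N \<ge> 0"
  shows "\<exists>N'\<ge>0. \<forall>D. div_recursive_bound C D \<longrightarrow>
    (\<forall>n. \<bar>D n\<bar> \<le> \<beta> * real n ^ 3 + N * (real n)\<^sup>2) \<longrightarrow>
    (\<forall>n. \<bar>D n\<bar> \<le> (7 / 8) * \<beta> * real n ^ 3 + N' * (real n)\<^sup>2)"
proof -
  \<comment> \<open>Chosen so that the harmonic part adds at most \<beta>/8 to the leading
    coefficient, for a total of 3/4 + 1/8 = 7/8. The summand 1 in \<open>N + 1\<close> avoids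
    division by zero.\<close>
  define \<eta> where "\<eta> = \<beta> / (8 * (N + 1))"
  have \<eta>: "\<eta> > 0" using assms by (simp add: \<eta>_def)
  have N\<eta>: "N * \<eta> \<le> \<beta> / 8"
    using assms by (simp add: \<eta>_def field_simps)
  obtain M where M: "M \<ge> 0" "\<And>n. (\<Sum>d = 2..n. 1 / real d) \<le> \<eta> * real n + M"
    by (rule sum_inverse_le[OF \<eta>]) (rule that)
  show ?thesis
  proof (intro exI[of _ "C + N * M"] conjI allI impI)
    show "C + N * M \<ge> 0" using assms M by simp
    fix D :: "nat \<Rightarrow> real" and n :: nat
    assume rec: "div_recursive_bound C D"
      and bound: "\<forall>n. \<bar>D n\<bar> \<le> \<beta> * real n ^ 3 + N * (real n)\<^sup>2"
    have "real d * \<bar>D (n div d)\<bar> \<le> \<beta> * real n ^ 3 * (1 / (real d)\<^sup>2) + N * (real n)\<^sup>2 * (1 / real d)"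
      if d: "d \<in> {2..n}" for d
    proof -
      have "\<bar>D (n div d)\<bar> \<le> \<beta> * real (n div d) ^ 3 + N * (real (n div d))\<^sup>2"
        using bound by blast
      also have "\<dots> \<le> \<beta> * (real n / real d) ^ 3 + N * (real n / real d)\<^sup>2"
        using assms by (intro add_mono mult_left_mono power_mono of_nat_div_le_of_nat) auto
      finally have "real d * \<bar>D (n div d)\<bar> \<le> real d * (\<beta> * (real n / real d) ^ 3 + N * (real n / real d)\<^sup>2)"
        by (intro mult_left_mono) auto
      also have "\<dots> = \<beta> * real n ^ 3 * (1 / (real d)\<^sup>2) + N * (real n)\<^sup>2 * (1 / real d)"
        using d by (simp add: power2_eq_square power3_eq_cube field_simps)
      finally show ?thesis .
    qed
    then have "(\<Sum>d = 2..n. real d * \<bar>D (n div d)\<bar>)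
        \<le> (\<Sum>d = 2..n. \<beta> * real n ^ 3 * (1 / (real d)\<^sup>2) + N * (real n)\<^sup>2 * (1 / real d))"
      by (rule sum_mono)
    also have "\<dots> = \<beta> * real n ^ 3 * (\<Sum>d = 2..n. 1 / (real d)\<^sup>2) + N * (real n)\<^sup>2 * (\<Sum>d = 2..n. 1 / real d)"
      by (simp add: sum.distrib sum_distrib_left)
    also have "\<dots> \<le> \<beta> * real n ^ 3 * (3 / 4) + N * (real n)\<^sup>2 * (\<eta> * real n + M)"
      using assms M by (intro add_mono mult_left_mono sum_inverse_squares_le) auto
    also have "\<dots> = \<beta> * real n ^ 3 * (3 / 4) + (N * \<eta>) * real n ^ 3 + N * M * (real n)\<^sup>2"
      by (simp add: algebra_simps power2_eq_square power3_eq_cube)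
    also have "\<dots> \<le> \<beta> * real n ^ 3 * (3 / 4) + (\<beta> / 8) * real n ^ 3 + N * M * (real n)\<^sup>2"
      using N\<eta> by (intro add_left_mono add_right_mono mult_right_mono) auto
    moreover have "\<bar>D n\<bar> \<le> C * (real n)\<^sup>2 + (\<Sum>d = 2..n. real d * \<bar>D (n div d)\<bar>)"
      using rec by (simp add: div_recursive_bound_def)
    ultimately show "\<bar>D n\<bar> \<le> (7 / 8) * \<beta> * real n ^ 3 + (C + N * M) * (real n)\<^sup>2"
      by (simp add: algebra_simps)
  qed
qed

text \<open>Iterates the contraction until (7/8)^k B < \<epsilon>. The order of quantifiers is
  essential: \<open>N\<close> is chosen before \<open>D\<close>, so one constant serves all
  directions.\<close>

lemma cubic_bound_arbitrarily_small:
  assumes "C \<ge> 0" "B > 0" "\<epsilon> > 0"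
  shows "\<exists>N\<ge>0. \<forall>D. div_recursive_bound C D \<longrightarrow> (\<forall>n. \<bar>D n\<bar> \<le> B * real n ^ 3) \<longrightarrow>
    (\<forall>n. \<bar>D n\<bar> \<le> \<epsilon> * real n ^ 3 + N * (real n)\<^sup>2)"
proof -
  have "\<exists>N\<ge>0. \<forall>D. div_recursive_bound C D \<longrightarrow> (\<forall>n. \<bar>D n\<bar> \<le> B * real n ^ 3) \<longrightarrow>
    (\<forall>n. \<bar>D n\<bar> \<le> ((7 / 8) ^ k * B) * real n ^ 3 + N * (real n)\<^sup>2)" for k
  proof (induction k)
    case 0
    show ?case by (intro exI[of _ 0]) auto
  next
    case (Suc k)
    then obtain N where "N \<ge> 0" and N: "\<forall>D. div_recursive_bound C D \<longrightarrow>
      (\<forall>n. \<bar>D n\<bar> \<le> B * real n ^ 3) \<longrightarrow>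
      (\<forall>n. \<bar>D n\<bar> \<le> ((7 / 8) ^ k * B) * real n ^ 3 + N * (real n)\<^sup>2)"
      by blast
    have pos: "(7 / 8) ^ k * B > 0" using assms by simp
    obtain N' where "N' \<ge> 0" and N': "\<forall>D. div_recursive_bound C D \<longrightarrow>
      (\<forall>n. \<bar>D n\<bar> \<le> ((7 / 8) ^ k * B) * real n ^ 3 + N * (real n)\<^sup>2) \<longrightarrow>
      (\<forall>n. \<bar>D n\<bar> \<le> (7 / 8) * ((7 / 8) ^ k * B) * real n ^ 3 + N' * (real n)\<^sup>2)"
      using cubic_bound_contracts[OF assms(1) pos \<open>N \<ge> 0\<close>] by blast
    have "\<forall>D. div_recursive_bound C D \<longrightarrow> (\<forall>n. \<bar>D n\<bar> \<le> B * real n ^ 3) \<longrightarrow>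
      (\<forall>n. \<bar>D n\<bar> \<le> (7 / 8) * ((7 / 8) ^ k * B) * real n ^ 3 + N' * (real n)\<^sup>2)"
      using N N' by blast
    then show ?case
      using \<open>N' \<ge> 0\<close> by (simp only: power_Suc mult.assoc) blast
  qed
  moreover obtain k where k: "(7 / 8 :: real) ^ k * B < \<epsilon>"
    using real_arch_pow_inv[of "\<epsilon> / B" "7 / 8"] assms by (auto simp: field_simps)
  ultimately obtain N where "N \<ge> 0" and N: "\<forall>D. div_recursive_bound C D \<longrightarrow>
      (\<forall>n. \<bar>D n\<bar> \<le> B * real n ^ 3) \<longrightarrow>
      (\<forall>n. \<bar>D n\<bar> \<le> ((7 / 8) ^ k * B) * real n ^ 3 + N * (real n)\<^sup>2)"
    by blast
  moreover have "((7 / 8) ^ k * B) * real n ^ 3 + N * (real n)\<^sup>2 \<le> \<epsilon> * real n ^ 3 + N * (real n)\<^sup>2" for n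
    using k by (intro add_right_mono mult_right_mono) auto
  ultimately show ?thesis
    by (meson order_trans)
qed

section \<open>Lattice sums along the levels of the 1-norm\<close>

definition ball1 :: "nat \<Rightarrow> (int \<times> int) set" where
  "ball1 n = {(a, b). \<bar>a\<bar> + \<bar>b\<bar> \<le> int n}"

text \<open>For positive \<open>n\<close> these are the vectors of \<open>V n diamond\<close> before
  the embedding into the reals.\<close>

definition prim1 :: "nat \<Rightarrow> (int \<times> int) set" where
  "prim1 n = {(a, b). \<bar>a\<bar> + \<bar>b\<bar> \<le> int n \<and> gcd a b = 1}"

definition linabs :: "real \<Rightarrow> real \<Rightarrow> int \<times> int \<Rightarrow> real" where
  "linabs \<alpha> \<beta> v = \<bar>\<alpha> * of_int (fst v) + \<beta> * of_int (snd v)\<bar>"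

lemma linabs_nonneg [simp]: "linabs \<alpha> \<beta> v \<ge> 0"
  by (simp add: linabs_def)

lemma finite_ball1 [simp]: "finite (ball1 n)"
  by (rule finite_subset[of _ "{- int n..int n} \<times> {- int n..int n}"]) (auto simp: ball1_def)

lemma prim1_subset: "prim1 n \<subseteq> ball1 n"
  by (auto simp: prim1_def ball1_def)

lemma finite_prim1 [simp]: "finite (prim1 n)"
  using finite_subset[OF prim1_subset] by simp

text \<open>Every nonzero lattice point is uniquely d times a primitive one, with d its gcd, and the
  norm bound n becomes \<open>n div d\<close>. The origin contributes 0.\<close>

lemma sum_ball1_eq_sum_prim1:
  "(\<Sum>v\<in>ball1 n. linabs \<alpha> \<beta> v) = (\<Sum>d = 1..n. real d * (\<Sum>v\<in>prim1 (n div d). linabs \<alpha> \<beta> v))"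
proof -
  have "(\<Sum>v\<in>ball1 n. linabs \<alpha> \<beta> v) = (\<Sum>v\<in>ball1 n - {0}. linabs \<alpha> \<beta> v)"
    by (rule sum.mono_neutral_right) (auto simp: linabs_def)
  also have "\<dots> = (\<Sum>(d, v)\<in>(SIGMA d:{1..n}. prim1 (n div d)). real d * linabs \<alpha> \<beta> v)"
  proof (rule sum.reindex_bij_witness[where
        i = "\<lambda>(d, a, b). (int d * a, int d * b)" and
        j = "\<lambda>(a, b). (nat (gcd a b), a div gcd a b, b div gcd a b)"])
    fix v assume v: "v \<in> ball1 n - {0}"
    obtain a b where ab: "v = (a, b)" by (cases v)
    have g: "gcd a b > 0" using v ab by (auto simp: zero_prod_def gcd_eq_0_iff intro: neq_le_trans)
    have co: "gcd (a div gcd a b) (b div gcd a b) = 1"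
    proof -
      have "a \<noteq> 0 \<or> b \<noteq> 0" using g by auto
      then show ?thesis
        using div_gcd_coprime coprime_iff_gcd_eq_1 by blast
    qed
    have "\<bar>gcd a b * x\<bar> = gcd a b * \<bar>x\<bar>" for x
      by (simp add: abs_mult)
    from this[of "a div gcd a b"] this[of "b div gcd a b"]
    have split: "gcd a b * \<bar>a div gcd a b\<bar> = \<bar>a\<bar>" "gcd a b * \<bar>b div gcd a b\<bar> = \<bar>b\<bar>"
      by simp_all
    have le: "gcd a b * (\<bar>a div gcd a b\<bar> + \<bar>b div gcd a b\<bar>) \<le> int n"
      using v ab split by (auto simp: ball1_def distrib_left)
    have pos: "\<bar>a div gcd a b\<bar> + \<bar>b div gcd a b\<bar> \<ge> 1"
      using co by (cases "a div gcd a b = 0") auto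
    have "gcd a b \<le> gcd a b * (\<bar>a div gcd a b\<bar> + \<bar>b div gcd a b\<bar>)"
      using pos g by simp
    then have "gcd a b \<le> int n"
      using le by linarith
    then have mem: "nat (gcd a b) \<in> {1..n}"
      unfolding atLeastAtMost_iff using g by linarith
    have "\<bar>a div gcd a b\<bar> + \<bar>b div gcd a b\<bar> \<le> int n div gcd a b"
      using zdiv_mono1[OF le g] g unfolding nonzero_mult_div_cancel_left[OF less_imp_neq[OF g, symmetric]] by blast
    moreover have "int (n div nat (gcd a b)) = int n div gcd a b"
      using g by (simp add: zdiv_int)
    ultimately show "(case v of (a, b) \<Rightarrow> (nat (gcd a b), a div gcd a b, b div gcd a b)) \<in> (SIGMA d:{1..n}. prim1 (n div d))"
      using co mem by (simp add: ab prim1_def)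
    show "(case case v of (a, b) \<Rightarrow> (nat (gcd a b), a div gcd a b, b div gcd a b) of
         (d, a, b) \<Rightarrow> (int d * a, int d * b)) = v"
      using g by (simp add: ab)
    have "linabs \<alpha> \<beta> (gcd a b * (a div gcd a b), gcd a b * (b div gcd a b)) = gcd a b * linabs \<alpha> \<beta> (a div gcd a b, b div gcd a b)"
    proof -
      have *: "linabs \<alpha> \<beta> (g * x, g * y) = \<bar>of_int g\<bar> * linabs \<alpha> \<beta> (x, y)" for g x y
        unfolding linabs_def abs_mult[symmetric] by (simp add: algebra_simps)
      show ?thesis
        unfolding * using g by (simp only: abs_of_pos of_int_0_less_iff)
    qed
    then show "(case case v of (a, b) \<Rightarrow> (nat (gcd a b), a div gcd a b, b div gcd a b) of
         (d, v) \<Rightarrow> real d * linabs \<alpha> \<beta> v) = linabs \<alpha> \<beta> v"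
      using g by (simp add: ab)
  next
    fix x assume x: "x \<in> (SIGMA d:{1..n}. prim1 (n div d))"
    obtain d a b where dab: "x = (d, a, b)" by (cases x)
    have d: "1 \<le> d" "d \<le> n" and ab: "\<bar>a\<bar> + \<bar>b\<bar> \<le> int (n div d)" "gcd a b = 1"
      using x dab by (auto simp: prim1_def)
    have g: "gcd (int d * a) (int d * b) = int d"
      using ab(2) gcd_mult_distrib_int[of "int d" a b] by simp
    have "int d * (\<bar>a\<bar> + \<bar>b\<bar>) \<le> int d * int (n div d)"
      using ab by (intro mult_left_mono) auto
    also have "\<dots> \<le> int n"
      by (metis of_nat_le_iff of_nat_mult times_div_less_eq_dividend)
    finally have "\<bar>int d * a\<bar> + \<bar>int d * b\<bar> \<le> int n"
      by (simp add: abs_mult distrib_left)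
    moreover have "(int d * a, int d * b) \<noteq> 0"
      using d ab by (auto simp: zero_prod_def)
    ultimately show "(case x of (d, a, b) \<Rightarrow> (int d * a, int d * b)) \<in> ball1 n - {0}"
      by (auto simp: dab ball1_def)
    show "(case case x of (d, a, b) \<Rightarrow> (int d * a, int d * b) of
          (a, b) \<Rightarrow> (nat (gcd a b), a div gcd a b, b div gcd a b)) = x"
      using d by (simp add: dab g)
  qed
  also have "\<dots> = (\<Sum>d = 1..n. \<Sum>v\<in>prim1 (n div d). real d * linabs \<alpha> \<beta> v)"
    by (rule sum.Sigma[symmetric]) auto
  finally show ?thesis
    by (simp add: sum_distrib_left)
qed

definition sphere1 :: "nat \<Rightarrow> (int \<times> int) set" where
  "sphere1 n = {(a, b). \<bar>a\<bar> + \<bar>b\<bar> = int n}"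

lemma finite_sphere1 [simp]: "finite (sphere1 n)"
  by (rule finite_subset[OF _ finite_ball1[of n]]) (auto simp: sphere1_def ball1_def)

lemma sum_ball1_eq_sum_sphere1: "sum f (ball1 n) = (\<Sum>m\<le>n. sum f (sphere1 m))"
proof (induction n)
  case 0
  have "ball1 0 = sphere1 0" by (auto simp: ball1_def sphere1_def)
  then show ?case by simp
next
  case (Suc n)
  have "ball1 (Suc n) = ball1 n \<union> sphere1 (Suc n)" "ball1 n \<inter> sphere1 (Suc n) = {}"
    by (auto simp: ball1_def sphere1_def)
  then show ?case
    using Suc by (simp add: sum.union_disjoint)
qed

text \<open>The level square is cut counterclockwise into four half-open sides, so each corner is
  counted once; this requires m > 0, where the corners are distinct.\<close>

lemma sum_sphere1:
  assumes "m > 0"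
  shows "sum f (sphere1 m) = (\<Sum>j<m. f (int m - int j, int j) + f (- int j, int m - int j)
    + f (int j - int m, - int j) + f (int j, int j - int m))"
proof -
  let ?g1 = "\<lambda>j. (int m - int j, int j)" and ?g2 = "\<lambda>j. (- int j, int m - int j)"
    and ?g3 = "\<lambda>j. (int j - int m, - int j)" and ?g4 = "\<lambda>j. (int j, int j - int m)"
  have "sphere1 m \<subseteq> ?g1 ` {..<m} \<union> ?g2 ` {..<m} \<union> ?g3 ` {..<m} \<union> ?g4 ` {..<m}"
  proof
    fix v assume "v \<in> sphere1 m"
    then obtain a b where v: "v = (a, b)" and ab: "\<bar>a\<bar> + \<bar>b\<bar> = int m"
      by (auto simp: sphere1_def)
    consider "a > 0" "b \<ge> 0" | "a \<le> 0" "b > 0" | "a < 0" "b \<le> 0" | "a \<ge> 0" "b < 0"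
      using ab assms by linarith
    then show "v \<in> ?g1 ` {..<m} \<union> ?g2 ` {..<m} \<union> ?g3 ` {..<m} \<union> ?g4 ` {..<m}"
    proof cases
      case 1
      then have "v \<in> ?g1 ` {..<m}"
        using ab v by (intro image_eqI[of _ _ "nat b"]) auto
      then show ?thesis by blast
    next
      case 2
      then have "v \<in> ?g2 ` {..<m}"
        using ab v by (intro image_eqI[of _ _ "nat (- a)"]) auto
      then show ?thesis by blast
    next
      case 3
      then have "v \<in> ?g3 ` {..<m}"
        using ab v by (intro image_eqI[of _ _ "nat (- b)"]) auto
      then show ?thesis by blast
    next
      case 4
      then have "v \<in> ?g4 ` {..<m}"
        using ab v by (intro image_eqI[of _ _ "nat a"]) auto
      then show ?thesis by blast
    qed
  qed
  moreover have "?g1 ` {..<m} \<union> ?g2 ` {..<m} \<union> ?g3 ` {..<m} \<union> ?g4 ` {..<m} \<subseteq> sphere1 m"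
    by (auto simp: sphere1_def)
  ultimately have "sphere1 m = ?g1 ` {..<m} \<union> (?g2 ` {..<m} \<union> (?g3 ` {..<m} \<union> ?g4 ` {..<m}))"
    by blast
  moreover have "sum f \<dots> = sum f (?g1 ` {..<m}) + (sum f (?g2 ` {..<m}) + (sum f (?g3 ` {..<m}) + sum f (?g4 ` {..<m})))"
    by (subst sum.union_disjoint; (subst sum.union_disjoint)?; (subst sum.union_disjoint)?; auto)
  moreover have "inj_on ?g1 {..<m}" "inj_on ?g2 {..<m}" "inj_on ?g3 {..<m}" "inj_on ?g4 {..<m}"
    by (auto simp: inj_on_def)
  ultimately show ?thesis
    by (simp add: sum.reindex sum.distrib algebra_simps)
qed

lemma sum_abs_linear_approx:
  fixes \<beta> :: real
  assumes "0 \<le> \<beta>" "\<beta> \<le> 1"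
  shows "\<bar>(\<Sum>j<m. \<bar>real j - \<beta> * real m\<bar>) - (real m)\<^sup>2 * ((1 - \<beta>)\<^sup>2 + \<beta>\<^sup>2) / 2\<bar> \<le> real m / 2"
proof -
  \<comment> \<open>An antiderivative of the absolute value. \<open>F (y + 1) - F y\<close> is the
    integral over a unit interval, within 1/2 of the value at its left end, and these differences
    telescope.\<close>
  define F where "F y = y * \<bar>y\<bar> / 2" for y :: real
  have F: "\<bar>\<bar>y\<bar> - (F (y + 1) - F y)\<bar> \<le> 1 / 2" for y
  proof -
    consider "y \<ge> 0" | "y \<le> -1" | "- 1 < y" "y < 0" by linarith
    then show ?thesis
    proof cases
      case 3
      have "\<bar>y\<bar> - (F (y + 1) - F y) = 1 / 2 - (y + 1) * (y + 1)"
        using 3 by (simp add: F_def field_simps)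
      moreover have "(y + 1) * (y + 1) \<le> 1 * 1"
        using 3 by (intro mult_mono) auto
      moreover have "(y + 1) * (y + 1) \<ge> 0" by simp
      ultimately show ?thesis
        by linarith
    qed (auto simp: F_def field_simps abs_le_iff)
  qed
  define x where "x j = real j - \<beta> * real m" for j
  have "x (Suc j) = x j + 1" for j
    by (simp add: x_def)
  then have "F (x m) - F (x 0) = (\<Sum>j<m. F (x j + 1) - F (x j))"
    using sum_lessThan_telescope[of "\<lambda>j. F (x j)" m] by simp
  moreover have "F (x m) - F (x 0) = (real m)\<^sup>2 * ((1 - \<beta>)\<^sup>2 + \<beta>\<^sup>2) / 2"
  proof -
    have x: "x m = (1 - \<beta>) * real m" "x 0 = - (\<beta> * real m)"
      by (simp_all add: x_def algebra_simps)
    have abs: "\<bar>(1 - \<beta>) * real m\<bar> = (1 - \<beta>) * real m" "\<bar>- (\<beta> * real m)\<bar> = \<beta> * real m"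
      using assms by (simp_all add: abs_mult)
    show ?thesis
      unfolding F_def x abs by (simp add: power2_eq_square field_simps)
  qed
  ultimately have "(\<Sum>j<m. \<bar>x j\<bar>) - (real m)\<^sup>2 * ((1 - \<beta>)\<^sup>2 + \<beta>\<^sup>2) / 2 =
      (\<Sum>j<m. \<bar>x j\<bar> - (F (x j + 1) - F (x j)))"
    by (simp only: sum_subtractf)
  moreover have "\<bar>\<Sum>j<m. \<bar>x j\<bar> - (F (x j + 1) - F (x j))\<bar> \<le> (\<Sum>j<m. 1 / 2)"
    by (intro order_trans[OF sum_abs] sum_mono F)
  ultimately show ?thesis
    by (simp add: x_def)
qed

text \<open>Origin of 1 - \<alpha>\<beta>: on two sides of the level square the linear form keeps
  its sign and contributes about m^2/2 each; on the other two it changes sign and contributes about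
  m^2 (\<alpha>^2 + \<beta>^2)/2 each. Since \<alpha> + \<beta> = 1, the total is 2 m^2 (1 -
  \<alpha>\<beta>).\<close>

lemma sum_sphere1_linabs:
  assumes "0 \<le> \<beta>" "\<beta> \<le> 1" "\<alpha> = 1 - \<beta>"
  shows "\<bar>sum (linabs \<alpha> \<beta>) (sphere1 m) - 2 * (real m)\<^sup>2 * (1 - \<alpha> * \<beta>)\<bar> \<le> 2 * real m"
proof (cases "m = 0")
  case True
  then have "sphere1 m = {(0, 0)}" by (auto simp: sphere1_def)
  then show ?thesis using True by (simp add: linabs_def)
next
  case False
  have 1: "linabs \<alpha> \<beta> (int m - int j, int j) = \<alpha> * real m + (\<beta> - \<alpha>) * real j"
    "linabs \<alpha> \<beta> (int j - int m, - int j) = \<alpha> * real m + (\<beta> - \<alpha>) * real j" if "j < m" for j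
  proof -
    have "\<alpha> * (real m - real j) + \<beta> * real j \<ge> 0"
      using assms that by (intro add_nonneg_nonneg mult_nonneg_nonneg) auto
    then show "linabs \<alpha> \<beta> (int m - int j, int j) = \<alpha> * real m + (\<beta> - \<alpha>) * real j"
      "linabs \<alpha> \<beta> (int j - int m, - int j) = \<alpha> * real m + (\<beta> - \<alpha>) * real j"
      by (auto simp: linabs_def algebra_simps)
  qed
  have 2: "linabs \<alpha> \<beta> (- int j, int m - int j) = \<bar>real j - \<beta> * real m\<bar>"
    "linabs \<alpha> \<beta> (int j, int j - int m) = \<bar>real j - \<beta> * real m\<bar>" for j
  proof -
    have "\<alpha> * (- real j) + \<beta> * (real m - real j) = - (real j - \<beta> * real m)"
      "\<alpha> * real j + \<beta> * (real j - real m) = real j - \<beta> * real m"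
      by (simp_all add: assms(3) algebra_simps)
    then show "linabs \<alpha> \<beta> (- int j, int m - int j) = \<bar>real j - \<beta> * real m\<bar>"
      "linabs \<alpha> \<beta> (int j, int j - int m) = \<bar>real j - \<beta> * real m\<bar>"
      by (simp_all add: linabs_def)
  qed
  have "sum (linabs \<alpha> \<beta>) (sphere1 m) = (\<Sum>j<m. 2 * (\<alpha> * real m + (\<beta> - \<alpha>) * real j) + 2 * \<bar>real j - \<beta> * real m\<bar>)"
    using False by (subst sum_sphere1) (auto simp: 1 2 intro!: sum.cong)
  also have "\<dots> = 2 * (\<Sum>j<m. \<alpha> * real m + (\<beta> - \<alpha>) * real j) + 2 * (\<Sum>j<m. \<bar>real j - \<beta> * real m\<bar>)"
    by (simp add: sum.distrib sum_distrib_left)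
  also have "(\<Sum>j<m. \<alpha> * real m + (\<beta> - \<alpha>) * real j) = (real m)\<^sup>2 / 2 - (\<beta> - \<alpha>) * real m / 2"
  proof -
    have *: "(\<Sum>j<k. c + e * real j) = c * real k + e * (real k * (real k - 1)) / 2" for k c e
      by (induction k) (auto simp: field_simps)
    show ?thesis
      unfolding * by (simp add: assms(3) power2_eq_square field_simps)
  qed
  finally have "sum (linabs \<alpha> \<beta>) (sphere1 m) - 2 * (real m)\<^sup>2 * (1 - \<alpha> * \<beta>) =
      2 * ((\<Sum>j<m. \<bar>real j - \<beta> * real m\<bar>) - (real m)\<^sup>2 * ((1 - \<beta>)\<^sup>2 + \<beta>\<^sup>2) / 2) - (\<beta> - \<alpha>) * real m"
    by (simp add: assms(3) power2_eq_square field_simps)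
  moreover have "\<bar>(\<beta> - \<alpha>) * real m\<bar> \<le> 1 * real m"
    unfolding abs_mult using assms by (intro mult_mono) auto
  moreover have "\<bar>2 * x - y\<bar> \<le> 2 * c" if "\<bar>y\<bar> \<le> 1 * c" "\<bar>x\<bar> \<le> c / 2" for x y c :: real
    using that by linarith
  ultimately show ?thesis
    using sum_abs_linear_approx[OF assms(1,2), of m] by presburger
qed

text \<open>The level errors add up to n^2 + n and the lower-order part of the sum of squares to at
  most n^2 + n/3; the bound 4 n^2 covers both.\<close>

lemma sum_ball1_linabs:
  assumes "0 \<le> \<beta>" "\<beta> \<le> 1" "\<alpha> = 1 - \<beta>"
  shows "\<bar>sum (linabs \<alpha> \<beta>) (ball1 n) - 2 / 3 * (1 - \<alpha> * \<beta>) * real n ^ 3\<bar> \<le> 4 * (real n)\<^sup>2"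
proof -
  define h where "h = 1 - \<alpha> * \<beta>"
  have h: "0 \<le> h" "h \<le> 1"
    using assms mult_le_one[of \<alpha> \<beta>] by (auto simp: h_def)
  have "\<bar>sum (linabs \<alpha> \<beta>) (ball1 n) - (\<Sum>m\<le>n. 2 * (real m)\<^sup>2 * h)\<bar> \<le> (\<Sum>m\<le>n. 2 * real m)"
    unfolding sum_ball1_eq_sum_sphere1 sum_subtractf[symmetric] h_def
    by (intro order_trans[OF sum_abs] sum_mono sum_sphere1_linabs assms)
  moreover have "(\<Sum>m\<le>n. 2 * real m) = real n * (real n + 1)"
    by (induction n) (auto simp: algebra_simps)
  moreover have "(\<Sum>m\<le>n. 2 * (real m)\<^sup>2 * h) = 2 / 3 * h * real n ^ 3 + h * ((real n)\<^sup>2 + real n / 3)"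
    by (induction n) (auto simp: field_simps power2_eq_square power3_eq_cube)
  moreover have "real n \<le> (real n)\<^sup>2"
    by (cases "n = 0") (auto simp: power2_eq_square)
  moreover have "h * ((real n)\<^sup>2 + real n / 3) \<le> 1 * ((real n)\<^sup>2 + real n / 3)" "0 \<le> h * ((real n)\<^sup>2 + real n / 3)"
    using h by (intro mult_right_mono mult_nonneg_nonneg; simp)+
  ultimately show ?thesis
    unfolding h_def[symmetric] by (simp add: algebra_simps power2_eq_square[of "real n"] abs_le_iff)
qed

section \<open>From all lattice points to primitive ones\<close>

definition prim_sum :: "real \<Rightarrow> real \<Rightarrow> nat \<Rightarrow> real" where
  "prim_sum \<alpha> \<beta> n = sum (linabs \<alpha> \<beta>) (prim1 n)"

lemma prim_sum_nonneg: "prim_sum \<alpha> \<beta> n \<ge> 0"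
  by (auto simp: prim_sum_def intro: sum_nonneg)

lemma prim_sum_le:
  assumes "0 \<le> \<beta>" "\<beta> \<le> 1" "\<alpha> = 1 - \<beta>"
  shows "prim_sum \<alpha> \<beta> n \<le> 2 / 3 * real n ^ 3 + 4 * (real n)\<^sup>2"
proof -
  have "prim_sum \<alpha> \<beta> n \<le> sum (linabs \<alpha> \<beta>) (ball1 n)"
    unfolding prim_sum_def by (intro sum_mono2 prim1_subset) auto
  also have "\<dots> \<le> 2 / 3 * (1 - \<alpha> * \<beta>) * real n ^ 3 + 4 * (real n)\<^sup>2"
    using sum_ball1_linabs[OF assms, of n] by linarith
  also have "\<dots> \<le> 2 / 3 * 1 * real n ^ 3 + 4 * (real n)\<^sup>2"
    using assms by (intro add_right_mono mult_right_mono mult_left_mono) auto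
  finally show ?thesis by simp
qed

lemma sum_ball1_split:
  assumes "n > 0"
  shows "sum (linabs \<alpha> \<beta>) (ball1 n) = prim_sum \<alpha> \<beta> n + (\<Sum>d = 2..n. real d * prim_sum \<alpha> \<beta> (n div d))"
  using assms unfolding sum_ball1_eq_sum_prim1 prim_sum_def[symmetric]
  by (subst sum.atLeast_Suc_atMost) (auto simp: numeral_2_eq_2)

text \<open>The direction (0, 1) serves as reference because its factor 1 - \<alpha>\<beta> is 1.
  Multiplying it by the factor of another direction matches the cubic main terms, and only quadratic
  errors enter the recursion.\<close>

lemma prim_sum_discrepancy:
  assumes "\<delta> > 0"
  shows "\<exists>N\<ge>0. \<forall>\<alpha> \<beta> n. 0 \<le> \<beta> \<longrightarrow> \<beta> \<le> 1 \<longrightarrow> \<alpha> = 1 - \<beta> \<longrightarrow>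
    \<bar>prim_sum \<alpha> \<beta> n - (1 - \<alpha> * \<beta>) * prim_sum 0 1 n\<bar> \<le> \<delta> * real n ^ 3 + N * (real n)\<^sup>2"
proof -
  \<comment> \<open>8 is twice the lattice error 4. 10 is a crude starting bound: each of the two
    primitive sums is at most (2/3 + 4) n^3.\<close>
  obtain N where "N \<ge> 0" and N: "\<forall>D. div_recursive_bound 8 D \<longrightarrow> (\<forall>n. \<bar>D n\<bar> \<le> 10 * real n ^ 3) \<longrightarrow>
    (\<forall>n. \<bar>D n\<bar> \<le> \<delta> * real n ^ 3 + N * (real n)\<^sup>2)"
    using cubic_bound_arbitrarily_small[of 8 10 \<delta>] assms by auto
  have "\<bar>prim_sum \<alpha> \<beta> n - (1 - \<alpha> * \<beta>) * prim_sum 0 1 n\<bar> \<le> \<delta> * real n ^ 3 + N * (real n)\<^sup>2"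
    if *: "0 \<le> \<beta>" "\<beta> \<le> 1" "\<alpha> = 1 - \<beta>" for \<alpha> \<beta> n
  proof -
    define h where "h = 1 - \<alpha> * \<beta>"
    have h: "0 \<le> h" "h \<le> 1"
      using * mult_le_one[of \<alpha> \<beta>] by (auto simp: h_def)
    define D where "D n = prim_sum \<alpha> \<beta> n - h * prim_sum 0 1 n" for n
    have "\<bar>D n\<bar> \<le> 8 * (real n)\<^sup>2 + (\<Sum>d = 2..n. real d * \<bar>D (n div d)\<bar>)" for n
    proof (cases "n = 0")
      \<comment> \<open>Splitting off d = 1 requires n > 0. At n = 0 there are no primitive points,
        because gcd 0 0 = 0.\<close>
      case True
      have "\<bar>a\<bar> + \<bar>b\<bar> \<le> 0 \<Longrightarrow> a = 0 \<and> b = 0" for a b :: int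
        by linarith
      then have "prim1 0 = {}"
        by (fastforce simp: prim1_def)
      then show ?thesis using True by (simp add: D_def prim_sum_def)
    next
      case False
      then have n: "n > 0" by simp
      have "D n = (sum (linabs \<alpha> \<beta>) (ball1 n) - h * sum (linabs 0 1) (ball1 n)) - (\<Sum>d = 2..n. real d * D (n div d))"
        unfolding sum_ball1_split[OF n] D_def
        by (simp add: algebra_simps sum_subtractf sum_distrib_left)
      moreover have "\<bar>sum (linabs \<alpha> \<beta>) (ball1 n) - h * sum (linabs 0 1) (ball1 n)\<bar> \<le> 8 * (real n)\<^sup>2"
      proof -
        have "\<bar>h * (sum (linabs 0 1) (ball1 n) - 2 / 3 * (1 - 0 * 1) * real n ^ 3)\<bar> \<le> 1 * (4 * (real n)\<^sup>2)"
          unfolding abs_mult using h by (intro mult_mono sum_ball1_linabs) auto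
        then have "\<bar>h * sum (linabs 0 1) (ball1 n) - 2 / 3 * h * real n ^ 3\<bar> \<le> 4 * (real n)\<^sup>2"
          by (simp add: algebra_simps)
        then show ?thesis
          using sum_ball1_linabs[OF *, of n] unfolding h_def[symmetric] by linarith
      qed
      moreover have "\<bar>\<Sum>d = 2..n. real d * D (n div d)\<bar> \<le> (\<Sum>d = 2..n. real d * \<bar>D (n div d)\<bar>)"
        by (rule order_trans[OF sum_abs]) (simp add: abs_mult)
      ultimately show ?thesis by linarith
    qed
    then have "div_recursive_bound 8 D" by (simp add: div_recursive_bound_def)
    moreover have "\<bar>D n\<bar> \<le> 10 * real n ^ 3" for n
    proof -
      have "h * prim_sum 0 1 n \<le> prim_sum 0 1 n" "0 \<le> h * prim_sum 0 1 n"
        using h prim_sum_nonneg[of 0 1 n] by (auto intro: mult_left_le_one_le)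
      moreover have "(real n)\<^sup>2 \<le> real n ^ 3"
        by (cases "n = 0") (auto intro: power_increasing)
      ultimately show ?thesis
        unfolding D_def using prim_sum_le[OF *, of n] prim_sum_le[of 1 0 n] prim_sum_nonneg[of \<alpha> \<beta> n]
        by (simp add: abs_le_iff)
    qed
    ultimately show ?thesis
      using N unfolding D_def h_def by blast
  qed
  then show ?thesis
    using \<open>N \<ge> 0\<close> by blast
qed

text \<open>In the decomposition of the lattice sum, with leading coefficient 2/3, the terms d \<ge>
  2 account for at most 2/3 * 3/4 + 4 * 1/48 = 7/12 of it. This leaves 1/12.\<close>

lemma prim_sum_lower:
  obtains M where "M \<ge> 0" "\<And>n. prim_sum 0 1 n \<ge> real n ^ 3 / 12 - M * (real n)\<^sup>2"
proof -
  obtain M where M: "M \<ge> 0" "\<And>n. (\<Sum>d = 2..n. 1 / real d) \<le> (1 / 48) * real n + M"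
    by (rule sum_inverse_le[of "1 / 48"]) (simp, rule that)
  have "prim_sum 0 1 n \<ge> real n ^ 3 / 12 - (4 + 4 * M) * (real n)\<^sup>2" for n
  proof (cases "n = 0")
    case True
    then show ?thesis using prim_sum_nonneg by simp
  next
    case False
    have "real d * prim_sum 0 1 (n div d) \<le> 2 / 3 * real n ^ 3 * (1 / (real d)\<^sup>2) + 4 * (real n)\<^sup>2 * (1 / real d)"
      if d: "d \<in> {2..n}" for d
    proof -
      have "prim_sum 0 1 (n div d) \<le> 2 / 3 * real (n div d) ^ 3 + 4 * (real (n div d))\<^sup>2"
        by (rule prim_sum_le) auto
      also have "\<dots> \<le> 2 / 3 * (real n / real d) ^ 3 + 4 * (real n / real d)\<^sup>2"
        by (intro add_mono mult_left_mono power_mono of_nat_div_le_of_nat) auto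
      finally have "real d * prim_sum 0 1 (n div d) \<le> real d * (2 / 3 * (real n / real d) ^ 3 + 4 * (real n / real d)\<^sup>2)"
        by (intro mult_left_mono) auto
      also have "\<dots> = 2 / 3 * real n ^ 3 * (1 / (real d)\<^sup>2) + 4 * (real n)\<^sup>2 * (1 / real d)"
        using d by (simp add: power2_eq_square power3_eq_cube field_simps)
      finally show ?thesis .
    qed
    then have "(\<Sum>d = 2..n. real d * prim_sum 0 1 (n div d))
        \<le> (\<Sum>d = 2..n. 2 / 3 * real n ^ 3 * (1 / (real d)\<^sup>2) + 4 * (real n)\<^sup>2 * (1 / real d))"
      by (rule sum_mono)
    also have "\<dots> = 2 / 3 * real n ^ 3 * (\<Sum>d = 2..n. 1 / (real d)\<^sup>2) + 4 * (real n)\<^sup>2 * (\<Sum>d = 2..n. 1 / real d)"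
      by (simp add: sum.distrib sum_distrib_left)
    also have "\<dots> \<le> 2 / 3 * real n ^ 3 * (3 / 4) + 4 * (real n)\<^sup>2 * ((1 / 48) * real n + M)"
      using M by (intro add_mono mult_left_mono sum_inverse_squares_le) auto
    also have "\<dots> = 7 / 12 * real n ^ 3 + 4 * M * (real n)\<^sup>2"
      by (simp add: algebra_simps power2_eq_square power3_eq_cube)
    finally have "(\<Sum>d = 2..n. real d * prim_sum 0 1 (n div d)) \<le> 7 / 12 * real n ^ 3 + 4 * M * (real n)\<^sup>2" .
    then show ?thesis
      using sum_ball1_split[of n 0 1] sum_ball1_linabs[of 1 0 n] False
      by (simp add: abs_le_iff algebra_simps)
  qed
  then show ?thesis
    using that[of "4 + 4 * M"] M(1) by simp
qed

lemma prim_sum_ratio: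
  assumes "\<delta> > 0"
  shows "\<exists>n0. \<forall>n>n0. prim_sum 0 1 n > 0 \<and> (\<forall>\<alpha> \<beta>. 0 \<le> \<beta> \<longrightarrow> \<beta> \<le> 1 \<longrightarrow> \<alpha> = 1 - \<beta> \<longrightarrow>
    \<bar>prim_sum \<alpha> \<beta> n / prim_sum 0 1 n - (1 - \<alpha> * \<beta>)\<bar> \<le> \<delta>)"
proof -
  obtain M where M: "M \<ge> 0" "\<And>n. prim_sum 0 1 n \<ge> real n ^ 3 / 12 - M * (real n)\<^sup>2"
    by (rule prim_sum_lower) (rule that)
  obtain N where N: "N \<ge> 0" "\<forall>\<alpha> \<beta> n. 0 \<le> \<beta> \<longrightarrow> \<beta> \<le> 1 \<longrightarrow> \<alpha> = 1 - \<beta> \<longrightarrow>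
    \<bar>prim_sum \<alpha> \<beta> n - (1 - \<alpha> * \<beta>) * prim_sum 0 1 n\<bar> \<le> (\<delta> / 48) * real n ^ 3 + N * (real n)\<^sup>2"
    using prim_sum_discrepancy[of "\<delta> / 48"] assms by auto
  \<comment> \<open>Beyond this threshold the quadratic loss halves the lower bound, from 1/12 to
    1/24, and the quadratic error is at most \<delta>/48 of n^3. Both error parts together are then
    \<delta>/24 of n^3, at most \<delta> times the axis sum.\<close>
  obtain n0 :: nat where n0: "24 * M + 48 * N / \<delta> < real n0"
    using reals_Archimedean2 by blast
  show ?thesis
  proof (intro exI[of _ n0] allI impI conjI)
    fix n assume n: "n > n0"
    have pos: "0 \<le> N / \<delta>" using N(1) assms by simp
    have "24 * M + 48 * (N / \<delta>) < real n"
      using n0 n by simp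
    then have "M \<le> real n / 24" "N / \<delta> \<le> real n / 48"
      using M(1) pos by linarith+
    then have "M * (real n)\<^sup>2 \<le> real n / 24 * (real n)\<^sup>2" "N \<le> \<delta> * real n / 48"
      using assms mult_right_mono[of M "real n / 24" "(real n)\<^sup>2"] by (simp_all add: field_simps)
    then have M': "M * (real n)\<^sup>2 \<le> real n ^ 3 / 24" and "N * (real n)\<^sup>2 \<le> \<delta> * real n / 48 * (real n)\<^sup>2"
      using mult_right_mono[of N "\<delta> * real n / 48" "(real n)\<^sup>2"]
      by (simp_all add: power2_eq_square power3_eq_cube)
    then have N': "N * (real n)\<^sup>2 \<le> \<delta> / 48 * real n ^ 3"
      by (simp add: power2_eq_square power3_eq_cube)
    have low: "prim_sum 0 1 n \<ge> real n ^ 3 / 24"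
      using M(2)[of n] M' by linarith
    moreover have "real n ^ 3 > 0" using n by simp
    ultimately show gt: "prim_sum 0 1 n > 0" by linarith
    fix \<alpha> \<beta> :: real
    assume *: "0 \<le> \<beta>" "\<beta> \<le> 1" "\<alpha> = 1 - \<beta>"
    have "\<bar>prim_sum \<alpha> \<beta> n - (1 - \<alpha> * \<beta>) * prim_sum 0 1 n\<bar> \<le> (\<delta> / 48) * real n ^ 3 + N * (real n)\<^sup>2"
      using N(2) * by blast
    also have "\<dots> \<le> \<delta> * (real n ^ 3 / 24)"
      using N' by simp
    also have "\<dots> \<le> \<delta> * prim_sum 0 1 n"
      using low assms by (intro mult_left_mono) auto
    finally have "\<bar>prim_sum \<alpha> \<beta> n - (1 - \<alpha> * \<beta>) * prim_sum 0 1 n\<bar> / prim_sum 0 1 n \<le> \<delta>"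
      using gt by (simp add: pos_divide_le_eq)
    moreover have "prim_sum \<alpha> \<beta> n / prim_sum 0 1 n - (1 - \<alpha> * \<beta>) =
        (prim_sum \<alpha> \<beta> n - (1 - \<alpha> * \<beta>) * prim_sum 0 1 n) / prim_sum 0 1 n"
      using gt by (simp add: field_simps)
    ultimately show "\<bar>prim_sum \<alpha> \<beta> n / prim_sum 0 1 n - (1 - \<alpha> * \<beta>)\<bar> \<le> \<delta>"
      using gt by (simp add: abs_divide)
  qed
qed

section \<open>The limit curve\<close>

lemma mem_diamond_iff: "(x, y) \<in> diamond \<longleftrightarrow> \<bar>x\<bar> + \<bar>y\<bar> \<le> 1"
proof
  have "convex {z :: real \<times> real. \<bar>fst z\<bar> + \<bar>snd z\<bar> \<le> 1}"
  proof (rule convexI)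
    fix v w :: "real \<times> real" and s t :: real
    assume *: "v \<in> {z. \<bar>fst z\<bar> + \<bar>snd z\<bar> \<le> 1}" "w \<in> {z. \<bar>fst z\<bar> + \<bar>snd z\<bar> \<le> 1}" "0 \<le> s" "0 \<le> t" "s + t = 1"
    have "\<bar>s * fst v + t * fst w\<bar> + \<bar>s * snd v + t * snd w\<bar>
        \<le> (\<bar>s * fst v\<bar> + \<bar>t * fst w\<bar>) + (\<bar>s * snd v\<bar> + \<bar>t * snd w\<bar>)"
      by (intro add_mono abs_triangle_ineq)
    also have "\<dots> = s * (\<bar>fst v\<bar> + \<bar>snd v\<bar>) + t * (\<bar>fst w\<bar> + \<bar>snd w\<bar>)"
      using * by (simp add: abs_mult algebra_simps)
    also have "\<dots> \<le> s * 1 + t * 1"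
      using * by (intro add_mono mult_left_mono) auto
    finally show "s *\<^sub>R v + t *\<^sub>R w \<in> {z. \<bar>fst z\<bar> + \<bar>snd z\<bar> \<le> 1}"
      using * by simp
  qed
  then have "diamond \<subseteq> {z. \<bar>fst z\<bar> + \<bar>snd z\<bar> \<le> 1}"
    unfolding diamond_def by (intro hull_minimal) auto
  then show "\<bar>x\<bar> + \<bar>y\<bar> \<le> 1" if "(x, y) \<in> diamond"
    using that by auto
next
  assume xy: "\<bar>x\<bar> + \<bar>y\<bar> \<le> 1"
  have conv: "convex diamond"
    unfolding diamond_def by (rule convex_convex_hull)
  have v: "(1, 0) \<in> diamond" "(- 1, 0) \<in> diamond" "(0, 1) \<in> diamond" "(0, - 1) \<in> diamond"
    unfolding diamond_def by (simp_all add: hull_inc)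
  define r where "r = \<bar>x\<bar> + \<bar>y\<bar>"
  have "(0, 0) \<in> diamond"
    using convexD[OF conv v(1,2), of "1 / 2" "1 / 2"] by simp
  have ex: "(sgn x, 0) \<in> diamond" and ey: "(0, sgn y) \<in> diamond"
    using v \<open>(0, 0) \<in> diamond\<close> by (auto simp: sgn_if)
  show "(x, y) \<in> diamond"
  proof (cases "r = 0")
    case True
    then have "x = 0" "y = 0" by (auto simp: r_def)
    then show ?thesis using \<open>(0, 0) \<in> diamond\<close> by simp
  next
    case False
    then have r: "0 < r" "r \<le> 1" using xy by (auto simp: r_def)
    \<comment> \<open>The boundary point on the ray through (x, y) is a combination of two vertices,
      or of a vertex and the origin when a coordinate vanishes; it is then shrunk towards the
      origin.\<close>
    have "(\<bar>x\<bar> / r) *\<^sub>R (sgn x, 0) + (\<bar>y\<bar> / r) *\<^sub>R (0, sgn y) \<in> diamond"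
      using r by (intro convexD[OF conv ex ey]) (auto simp: r_def simp flip: add_divide_distrib)
    then have *: "(x / r, y / r) \<in> diamond"
      by (simp add: abs_mult_sgn)
    have "r *\<^sub>R (x / r, y / r) + (1 - r) *\<^sub>R (0, 0) \<in> diamond"
      using r by (intro convexD[OF conv * \<open>(0, 0) \<in> diamond\<close>]) auto
    then show ?thesis
      using r by simp
  qed
qed

lemma V_diamond:
  assumes "Q > 0"
  shows "V Q diamond = (\<lambda>(a, b). (of_int a, of_int b)) ` prim1 Q"
proof -
  have "(of_int a / real Q, of_int b / real Q) \<in> diamond \<longleftrightarrow> \<bar>a\<bar> + \<bar>b\<bar> \<le> int Q" for a b :: int
  proof -
    have "(of_int a / real Q, of_int b / real Q) \<in> diamond \<longleftrightarrow> (\<bar>real_of_int a\<bar> + \<bar>of_int b\<bar>) / real Q \<le> 1"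
      by (simp add: mem_diamond_iff add_divide_distrib)
    also have "\<dots> \<longleftrightarrow> real_of_int (\<bar>a\<bar> + \<bar>b\<bar>) \<le> real_of_int (int Q)"
      using assms by (simp add: field_simps)
    finally show ?thesis
      by (simp only: of_int_le_iff)
  qed
  then show ?thesis
    unfolding V_def prim1_def by (auto simp: image_iff)
qed

lemma abs_support_V_diamond:
  assumes "Q > 0"
  shows "abs_support (V Q diamond) u = prim_sum (fst u) (snd u) Q / 4"
proof -
  have "inj_on (\<lambda>(a, b). (real_of_int a, real_of_int b)) (prim1 Q)"
    by (auto simp: inj_on_def)
  then show ?thesis
    unfolding abs_support_def V_diamond[OF assms] prim_sum_def
    by (subst sum.reindex) (auto simp: linabs_def inner_pair intro!: sum.cong)
qed

lemma dihedral_symmetric_V_diamond: "Q > 0 \<Longrightarrow> dihedral_symmetric (V Q diamond)"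
  unfolding V_diamond dihedral_symmetric_def
proof (intro allI impI)
  fix x y :: real
  assume "(x, y) \<in> (\<lambda>(a, b). (real_of_int a, real_of_int b)) ` prim1 Q"
  then obtain a b where ab: "(a, b) \<in> prim1 Q" "x = of_int a" "y = of_int b" by auto
  then have "(- a, b) \<in> prim1 Q" "(a, - b) \<in> prim1 Q" "(b, a) \<in> prim1 Q"
    by (auto simp: prim1_def gcd.commute add.commute)
  then show "(- x, y) \<in> (\<lambda>(a, b). (real_of_int a, real_of_int b)) ` prim1 Q \<and>
      (x, - y) \<in> (\<lambda>(a, b). (real_of_int a, real_of_int b)) ` prim1 Q \<and>
      (y, x) \<in> (\<lambda>(a, b). (real_of_int a, real_of_int b)) ` prim1 Q"
    using ab(2,3) by (force simp: image_iff)
qed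

text \<open>Cross-multiplication and coprimality make a and a' divide each other, and likewise b and
  b'. Thus each ray carries at most one primitive vector, as the zonotope construction
  demands.\<close>

lemma coprime_parallel_eq:
  fixes a b a' b' :: int
  assumes "gcd a b = 1" "gcd a' b' = 1" "c > 0" "of_int a' = c * of_int a" "of_int b' = c * of_int b"
  shows "c = (1 :: real)"
proof -
  have co: "coprime a b" "coprime a' b'"
    using assms(1,2) by (simp_all add: coprime_iff_gcd_eq_1)
  have "real_of_int (a' * b) = real_of_int (a * b')"
    using assms(4,5) by simp
  then have cross: "a' * b = a * b'" by (simp only: of_int_eq_iff)
  have "\<bar>a'\<bar> = \<bar>a\<bar>" "\<bar>b'\<bar> = \<bar>b\<bar>"
  proof -
    have "a dvd a' * b" "a' dvd a * b'" "b dvd a * b'" "b' dvd a' * b"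
      using cross by (metis dvd_triv_left dvd_triv_right)+
    then have "a dvd a'" "a' dvd a" "b dvd b'" "b' dvd b"
      using co by (auto simp: coprime_dvd_mult_left_iff coprime_dvd_mult_right_iff coprime_commute)
    then show "\<bar>a'\<bar> = \<bar>a\<bar>" "\<bar>b'\<bar> = \<bar>b\<bar>"
      by (auto intro: zdvd_antisym_abs)
  qed
  then have "c * \<bar>of_int a\<bar> = \<bar>real_of_int a\<bar>" "c * \<bar>of_int b\<bar> = \<bar>real_of_int b\<bar>"
    using assms(3-5) by (metis abs_mult abs_of_pos of_int_abs)+
  moreover have "a \<noteq> 0 \<or> b \<noteq> 0"
    using assms(1) by auto
  ultimately show ?thesis by auto
qed

lemma scaled_jarnik_polygon_diamond:
  assumes "Q > 0"
  shows "scaled_jarnik_polygon Q diamond =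
    (\<lambda>z. (1 / abs_support (V Q diamond) (0, 1)) *\<^sub>R z) ` frontier (zonotope (V Q diamond))"
proof (rule scaled_jarnik_polygon_eq)
  show "finite (V Q diamond)" "dihedral_symmetric (V Q diamond)"
    using dihedral_symmetric_V_diamond[OF assms] by (simp_all add: V_diamond[OF assms])
  show "(1, 0) \<in> V Q diamond" "0 \<notin> V Q diamond"
    using assms by (force simp: V_diamond prim1_def zero_prod_def image_iff)+
  have rep: "\<exists>a b. w = (of_int a, of_int b) \<and> gcd a b = 1" if "w \<in> V Q diamond" for w
    using that unfolding V_diamond[OF assms] prim1_def by auto
  fix v and c :: real
  assume "v \<in> V Q diamond" "c > 0" "c *\<^sub>R v \<in> V Q diamond"
  then obtain a b a' b' :: int where "v = (of_int a, of_int b)" "gcd a b = 1"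
    "c *\<^sub>R v = (of_int a', of_int b')" "gcd a' b' = 1"
    using rep by metis
  then show "c = 1"
    using \<open>c > 0\<close> by (intro coprime_parallel_eq[of a b a' b' c]) simp_all
qed simp

text \<open>Homogeneity of the support function allows the touching direction to be normalized by
  the 1-norm, which is where the lattice estimates apply. The factors 1/4 cancel in the
  quotient.\<close>

lemma scaled_polygon_support:
  assumes "Q > 0" "prim_sum 0 1 Q > 0" and z: "z \<in> scaled_jarnik_polygon Q diamond"
  shows "\<And>\<alpha> \<beta>. \<alpha> * fst z + \<beta> * snd z \<le> prim_sum \<alpha> \<beta> Q / prim_sum 0 1 Q"
    "\<exists>\<alpha> \<beta>. \<bar>\<alpha>\<bar> + \<bar>\<beta>\<bar> = 1 \<and> \<alpha> * fst z + \<beta> * snd z = prim_sum \<alpha> \<beta> Q / prim_sum 0 1 Q"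
proof -
  let ?W = "V Q diamond"
  define H where "H = prim_sum 0 1 Q / 4"
  have H: "H > 0" "abs_support ?W (0, 1) = H"
    using assms by (simp_all add: H_def abs_support_V_diamond)
  obtain y where y: "y \<in> frontier (zonotope ?W)" "z = (1 / H) *\<^sub>R y"
    using z unfolding scaled_jarnik_polygon_diamond[OF assms(1)] H(2) by blast
  have W: "finite ?W" "\<And>v. v \<in> ?W \<Longrightarrow> - v \<in> ?W"
    using assms(1) dihedral_symmetric_uminus[OF dihedral_symmetric_V_diamond] by (auto simp: V_diamond)
  have eq: "\<alpha> * fst z + \<beta> * snd z = ((\<alpha>, \<beta>) \<bullet> y) / H" for \<alpha> \<beta>
    using y(2) by (simp add: inner_pair add_divide_distrib)
  have supp: "abs_support ?W (\<alpha>, \<beta>) / H = prim_sum \<alpha> \<beta> Q / prim_sum 0 1 Q" for \<alpha> \<beta>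
    using assms by (simp add: abs_support_V_diamond H_def)
  show "\<alpha> * fst z + \<beta> * snd z \<le> prim_sum \<alpha> \<beta> Q / prim_sum 0 1 Q" for \<alpha> \<beta>
    unfolding eq supp[symmetric] using H(1) frontier_zonotope_support(1)[OF W y(1)]
    by (intro divide_right_mono) auto
  obtain u where u: "u \<noteq> 0" "u \<bullet> y = abs_support ?W u"
    using frontier_zonotope_support(2)[OF W y(1)] by blast
  define s where "s = \<bar>fst u\<bar> + \<bar>snd u\<bar>"
  have s: "s > 0"
    using u(1) by (auto simp: s_def prod_eq_iff)
  have "(fst u / s, snd u / s) = (1 / s) *\<^sub>R u"
    by (simp add: prod_eq_iff)
  moreover have "abs_support ?W ((1 / s) *\<^sub>R u) = (1 / s) * abs_support ?W u"
    using s by (simp add: abs_support_def abs_mult flip: sum_divide_distrib)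
  ultimately have "(fst u / s, snd u / s) \<bullet> y = abs_support ?W (fst u / s, snd u / s)"
    using u(2) by simp
  then have "fst u / s * fst z + snd u / s * snd z = prim_sum (fst u / s) (snd u / s) Q / prim_sum 0 1 Q"
    unfolding eq supp[symmetric] by simp
  moreover have "\<bar>fst u / s\<bar> + \<bar>snd u / s\<bar> = 1"
    using s by (simp add: s_def flip: add_divide_distrib)
  ultimately show "\<exists>\<alpha> \<beta>. \<bar>\<alpha>\<bar> + \<bar>\<beta>\<bar> = 1 \<and> \<alpha> * fst z + \<beta> * snd z = prim_sum \<alpha> \<beta> Q / prim_sum 0 1 Q"
    by blast
qed

lemma prim_sum_abs:
  assumes "Q > 0"
  shows "prim_sum \<alpha> \<beta> Q = prim_sum \<bar>\<alpha>\<bar> \<bar>\<beta>\<bar> Q"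
  using abs_support_symmetric(1)[OF dihedral_symmetric_V_diamond[OF assms], of \<alpha> \<beta>]
    abs_support_symmetric(2)[OF dihedral_symmetric_V_diamond[OF assms], of "- \<alpha>" \<beta>]
    abs_support_symmetric(2)[OF dihedral_symmetric_V_diamond[OF assms], of \<alpha> \<beta>]
  by (auto simp: abs_support_V_diamond[OF assms] abs_if)

text \<open>
  On \<open>\<bar>\<alpha>\<bar> + \<bar>\<beta>\<bar> = 1\<close>, the support function of the region bounded by \<^term>\<open>limit_curve\<close> is
  \<open>1 - \<bar>\<alpha>\<bar> * \<bar>\<beta>\<bar>\<close>. With \<open>p = sqrt (1 - \<bar>x\<bar>)\<close> and \<open>q = sqrt (1 - \<bar>y\<bar>)\<close>, one inclusion comes from
  \<open>a * p\<^sup>2 + b * q\<^sup>2 - a * b * (p + q)\<^sup>2 = (a * p - b * q)\<^sup>2\<close> for \<open>a + b = 1\<close>. For the other, if \<open>p + q < 1\<close>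
  then any \<open>b\<close> strictly between \<open>p\<close> and \<open>1 - q\<close> gives a direction \<open>(1 - b, b)\<close> that excludes the point.
\<close>

lemma sqrt_sum_ge_one_imp_support_le:
  assumes z: "sqrt (1 - \<bar>x\<bar>) + sqrt (1 - \<bar>y\<bar>) \<ge> 1" and ab: "\<bar>\<alpha>\<bar> + \<bar>\<beta>\<bar> = 1"
  shows "\<alpha> * x + \<beta> * y \<le> 1 - \<bar>\<alpha>\<bar> * \<bar>\<beta>\<bar>"
proof -
  define p q where "p = sqrt (1 - \<bar>x\<bar>)" and "q = sqrt (1 - \<bar>y\<bar>)"
  \<comment> \<open>\<open>sqrt\<close> is an odd function on the reals, so p and q could a priori
    be negative. Both are at most 1 and their sum is at least 1, which excludes this and also bounds
    |x| and |y| by 1.\<close>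
  have "p \<le> 1" "q \<le> 1" by (simp_all add: p_def q_def)
  moreover have "p + q \<ge> 1" using z by (simp add: p_def q_def)
  ultimately have pq: "p \<ge> 0" "q \<ge> 0" "p + q \<ge> 1" by linarith+
  have "1 - \<bar>x\<bar> \<ge> 0" "1 - \<bar>y\<bar> \<ge> 0"
    using pq(1,2) by (simp_all add: p_def q_def)
  then have x: "\<bar>x\<bar> = 1 - p\<^sup>2" and y: "\<bar>y\<bar> = 1 - q\<^sup>2"
    by (simp_all add: p_def q_def)
  define a b where "a = \<bar>\<alpha>\<bar>" and "b = \<bar>\<beta>\<bar>"
  have b: "b = 1 - a" and a0: "a \<ge> 0" "b \<ge> 0" using ab by (simp_all add: a_def b_def)
  have "\<alpha> * x \<le> a * \<bar>x\<bar>" "\<beta> * y \<le> b * \<bar>y\<bar>"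
    unfolding a_def b_def abs_mult[symmetric] by simp_all
  then have "\<alpha> * x + \<beta> * y \<le> a * \<bar>x\<bar> + b * \<bar>y\<bar>" by simp
  also have "\<dots> = 1 - (a * p - b * q)\<^sup>2 - a * b * (p + q)\<^sup>2"
    unfolding x y b by (simp add: power2_eq_square algebra_simps)
  also have "\<dots> \<le> 1 - a * b * 1"
  proof -
    have "a * b * 1 \<le> a * b * (p + q)\<^sup>2"
      using pq(3) a0 by (intro mult_left_mono) auto
    then show ?thesis
      using zero_le_power2[of "a * p - b * q"] by linarith
  qed
  finally show ?thesis by (simp add: a_def b_def)
qed

lemma support_le_imp_sqrt_sum_ge_one:
  assumes x: "\<bar>x\<bar> \<le> 1" and y: "\<bar>y\<bar> \<le> 1"
    and supp: "\<And>\<alpha> \<beta>. \<bar>\<alpha>\<bar> + \<bar>\<beta>\<bar> = 1 \<Longrightarrow> \<alpha> * x + \<beta> * y \<le> 1 - \<bar>\<alpha>\<bar> * \<bar>\<beta>\<bar>"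
  shows "sqrt (1 - \<bar>x\<bar>) + sqrt (1 - \<bar>y\<bar>) \<ge> 1"
proof (rule ccontr)
  define p q where "p = sqrt (1 - \<bar>x\<bar>)" and "q = sqrt (1 - \<bar>y\<bar>)"
  have pq: "p \<ge> 0" "q \<ge> 0" "\<bar>x\<bar> = 1 - p\<^sup>2" "\<bar>y\<bar> = 1 - q\<^sup>2"
    using x y by (simp_all add: p_def q_def)
  assume "\<not> sqrt (1 - \<bar>x\<bar>) + sqrt (1 - \<bar>y\<bar>) \<ge> 1"
  then have lt: "p + q < 1" by (simp add: p_def q_def)
  define b where "b = (p + 1 - q) / 2"
  have b: "p < b" "q < 1 - b" using lt by (simp_all add: b_def field_simps)
  have b01: "0 < b" "b < 1" using b pq by simp_all
  define \<alpha> \<beta> where "\<alpha> = (1 - b) * (if x \<ge> 0 then 1 else - 1)" and "\<beta> = b * (if y \<ge> 0 then 1 else - 1)"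
  have abs: "\<bar>\<alpha>\<bar> = 1 - b" "\<bar>\<beta>\<bar> = b" and prod: "\<alpha> * x = (1 - b) * \<bar>x\<bar>" "\<beta> * y = b * \<bar>y\<bar>"
    using b01 by (auto simp: \<alpha>_def \<beta>_def)
  have "(1 - b) * \<bar>x\<bar> + b * \<bar>y\<bar> \<le> 1 - (1 - b) * b"
    using supp[of \<alpha> \<beta>] by (simp add: abs prod)
  \<comment> \<open>The right-hand sides add up to b (1 - b), whereas the support inequality says
    that the left-hand sides add up to at least that.\<close>
  moreover have "(1 - b) * p\<^sup>2 < (1 - b) * b\<^sup>2" "b * q\<^sup>2 < b * (1 - b)\<^sup>2"
    using b b01 pq by (auto intro!: mult_strict_left_mono power_strict_mono)
  ultimately show False
    unfolding pq(3,4) by (simp add: power2_eq_square algebra_simps)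
qed

text \<open>On the ray through the point, the function that defines the curve passes the value 1 at
  a dilation factor within 6 \<delta> of 1. The point has norm at most 3, hence 18 \<delta>.\<close>

lemma infdist_limit_curve_le:
  fixes x y \<delta> :: real
  assumes \<delta>: "0 < \<delta>" "\<delta> \<le> 1 / 6"
    and upper: "\<And>\<alpha> \<beta>. \<bar>\<alpha>\<bar> + \<bar>\<beta>\<bar> = 1 \<Longrightarrow> \<alpha> * x + \<beta> * y \<le> 1 - \<bar>\<alpha>\<bar> * \<bar>\<beta>\<bar> + \<delta>"
    and lower: "\<bar>\<alpha>0\<bar> + \<bar>\<beta>0\<bar> = 1" "\<alpha>0 * x + \<beta>0 * y \<ge> 1 - \<bar>\<alpha>0\<bar> * \<bar>\<beta>0\<bar> - \<delta>"
  shows "infdist (x, y) limit_curve \<le> 18 * \<delta>"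
proof -
  have h: "1 - \<bar>\<alpha>\<bar> * \<bar>\<beta>\<bar> \<ge> 3 / 4" if "\<bar>\<alpha>\<bar> + \<bar>\<beta>\<bar> = 1" for \<alpha> \<beta> :: real
  proof -
    have "1 - a * (1 - a) = 3 / 4 + (a - 1 / 2)\<^sup>2" for a :: real
      by (simp add: power2_eq_square algebra_simps)
    then have "1 - a * (1 - a) \<ge> 3 / 4" for a :: real
      by simp
    moreover have "\<bar>\<beta>\<bar> = 1 - \<bar>\<alpha>\<bar>" using that by simp
    ultimately show ?thesis by metis
  qed
  define \<phi> where "\<phi> t = sqrt (1 - t * \<bar>x\<bar>) + sqrt (1 - t * \<bar>y\<bar>)" for t
  \<comment> \<open>Limit support values are at least 3/4 by \<open>h\<close>, so relative changes
    of 2 \<delta> and 3 \<delta> absorb the additive error \<delta>. Dilation by \<open>t0\<close>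
    satisfies all limit inequalities; dilation by \<open>t1\<close> violates the one in direction
    (\<alpha>0, \<beta>0).\<close>
  define t0 t1 where "t0 = 1 / (1 + 2 * \<delta>)" and "t1 = 1 / (1 - 3 * \<delta>)"
  have t0: "0 < t0" "t0 \<le> 1" "1 - t0 \<le> 2 * \<delta>"
    using \<delta> by (auto simp: t0_def field_simps)
  have t1: "1 \<le> t1" "t1 - 1 \<le> 6 * \<delta>"
  proof -
    have "3 * \<delta> * (1 - 6 * \<delta>) \<ge> 0" using \<delta> by simp
    then have "1 \<le> (1 + 6 * \<delta>) * (1 - 3 * \<delta>)" by (simp add: algebra_simps)
    then show "1 \<le> t1" "t1 - 1 \<le> 6 * \<delta>"
      using \<delta> by (auto simp: t1_def field_simps)
  qed
  have "\<phi> t0 \<ge> 1"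
  proof -
    have scaled: "\<alpha> * (t0 * x) + \<beta> * (t0 * y) \<le> 1 - \<bar>\<alpha>\<bar> * \<bar>\<beta>\<bar>" if "\<bar>\<alpha>\<bar> + \<bar>\<beta>\<bar> = 1" for \<alpha> \<beta>
    proof -
      have "\<delta> \<le> 2 * \<delta> * (1 - \<bar>\<alpha>\<bar> * \<bar>\<beta>\<bar>)"
        using mult_left_mono[OF h[OF that], of "2 * \<delta>"] \<delta> by simp
      then have "\<alpha> * x + \<beta> * y \<le> (1 + 2 * \<delta>) * (1 - \<bar>\<alpha>\<bar> * \<bar>\<beta>\<bar>)"
        using upper[OF that] by (simp add: algebra_simps)
      then have "t0 * (\<alpha> * x + \<beta> * y) \<le> t0 * ((1 + 2 * \<delta>) * (1 - \<bar>\<alpha>\<bar> * \<bar>\<beta>\<bar>))"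
        using t0 by (intro mult_left_mono) auto
      moreover have "t0 * ((1 + 2 * \<delta>) * c) = c" for c
        using \<delta> by (simp add: t0_def)
      moreover have "\<alpha> * (t0 * x) + \<beta> * (t0 * y) = t0 * (\<alpha> * x + \<beta> * y)"
        by (simp add: algebra_simps)
      ultimately show ?thesis by simp
    qed
    have "\<bar>t0 * x\<bar> \<le> 1" "\<bar>t0 * y\<bar> \<le> 1"
      using scaled[of 1 0] scaled[of "- 1" 0] scaled[of 0 1] scaled[of 0 "- 1"] by auto
    then have "sqrt (1 - \<bar>t0 * x\<bar>) + sqrt (1 - \<bar>t0 * y\<bar>) \<ge> 1"
      using scaled by (rule support_le_imp_sqrt_sum_ge_one)
    then show ?thesis
      using t0 by (simp add: \<phi>_def abs_mult)
  qed
  moreover have "\<phi> t1 \<le> 1"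
  proof (rule ccontr)
    assume "\<not> \<phi> t1 \<le> 1"
    then have "sqrt (1 - \<bar>t1 * x\<bar>) + sqrt (1 - \<bar>t1 * y\<bar>) \<ge> 1"
      using t1 by (simp add: \<phi>_def abs_mult)
    then have "\<alpha>0 * (t1 * x) + \<beta>0 * (t1 * y) \<le> 1 - \<bar>\<alpha>0\<bar> * \<bar>\<beta>0\<bar>"
      using lower(1) by (rule sqrt_sum_ge_one_imp_support_le)
    then have "t1 * (\<alpha>0 * x + \<beta>0 * y) \<le> 1 - \<bar>\<alpha>0\<bar> * \<bar>\<beta>0\<bar>"
      by (simp add: algebra_simps)
    then have "\<alpha>0 * x + \<beta>0 * y \<le> (1 - 3 * \<delta>) * (1 - \<bar>\<alpha>0\<bar> * \<bar>\<beta>0\<bar>)"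
      using \<delta> by (simp add: t1_def field_simps)
    moreover have "\<delta> < 3 * \<delta> * (1 - \<bar>\<alpha>0\<bar> * \<bar>\<beta>0\<bar>)"
      using mult_left_mono[OF h[OF lower(1)], of "3 * \<delta>"] \<delta> by simp
    ultimately show False
      using lower(2) by (simp add: algebra_simps)
  qed
  \<comment> \<open>\<open>sqrt\<close> is continuous on all of the reals, so the intermediate value
    theorem applies even if an argument becomes negative on the way.\<close>
  moreover have "continuous_on {t0..t1} \<phi>"
    unfolding \<phi>_def by (intro continuous_intros)
  moreover have "t0 \<le> t1" using t0 t1 by simp
  ultimately obtain t where t: "t0 \<le> t" "t \<le> t1" "\<phi> t = 1"
    using IVT2'[of \<phi> t1 1 t0] by blast
  have "t > 0" using t t0 by simp
  have "\<bar>t * x\<bar> \<le> 1" "\<bar>t * y\<bar> \<le> 1"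
  proof -
    \<comment> \<open>Two numbers at most 1 with sum 1 are both nonnegative, so the crossing point
      lies in the square where the curve is defined.\<close>
    have "sqrt (1 - t * \<bar>x\<bar>) \<le> 1" "sqrt (1 - t * \<bar>y\<bar>) \<le> 1"
      using \<open>t > 0\<close> by simp_all
    then have "sqrt (1 - t * \<bar>x\<bar>) \<ge> 0" "sqrt (1 - t * \<bar>y\<bar>) \<ge> 0"
      using t(3) unfolding \<phi>_def by linarith+
    then show "\<bar>t * x\<bar> \<le> 1" "\<bar>t * y\<bar> \<le> 1"
      using \<open>t > 0\<close> by (simp_all add: abs_mult)
  qed
  then have mem: "(t * x, t * y) \<in> limit_curve"
    using t(3) \<open>t > 0\<close> by (simp add: limit_curve_def \<phi>_def abs_mult)
  have xy: "\<bar>x\<bar> \<le> 1 + \<delta>" "\<bar>y\<bar> \<le> 1 + \<delta>"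
    using upper[of 1 0] upper[of "- 1" 0] upper[of 0 1] upper[of 0 "- 1"] by auto
  \<comment> \<open>\<open>infdist\<close> to an empty set is 0 by convention; here the bound comes
    from an actual point of the curve.\<close>
  have "infdist (x, y) limit_curve \<le> dist (x, y) (t * x, t * y)"
    using mem by (rule infdist_le)
  also have "dist (x, y) (t * x, t * y) = norm ((1 - t) *\<^sub>R (x, y))"
    by (simp add: dist_norm algebra_simps)
  also have "\<dots> = \<bar>1 - t\<bar> * norm (x, y)"
    by (rule norm_scaleR)
  also have "\<dots> \<le> (6 * \<delta>) * 3"
  proof (rule mult_mono)
    show "\<bar>1 - t\<bar> \<le> 6 * \<delta>" using t t0 t1 \<delta> by (auto simp: abs_le_iff)
    have "norm (x, y) \<le> \<bar>x\<bar> + \<bar>y\<bar>"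
      using norm_Pair_le[of x y] by simp
    then show "norm (x, y) \<le> 3" using xy \<delta> by linarith
  qed (use \<delta> in auto)
  finally show ?thesis by simp
qed

theorem theorem2:
  "\<forall>\<epsilon>::real. \<epsilon> > 0 \<longrightarrow>
     (\<exists>Q0::nat. \<forall>Q::nat. Q > Q0 \<longrightarrow>
        (\<forall>z \<in> scaled_jarnik_polygon Q diamond. infdist z limit_curve < \<epsilon>))"
proof (intro allI impI)
  fix \<epsilon> :: real assume \<epsilon>: "\<epsilon> > 0"
  \<comment> \<open>The dilation lemma needs \<delta> \<le> 1/6, and 19 instead of 18 makes the
    final inequality strict.\<close>
  define \<delta> where "\<delta> = min (1 / 6) (\<epsilon> / 19)"
  have \<delta>: "0 < \<delta>" "\<delta> \<le> 1 / 6" "18 * \<delta> < \<epsilon>"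
    using \<epsilon> by (auto simp: \<delta>_def min_def)
  obtain Q0 where Q0: "\<forall>Q>Q0. prim_sum 0 1 Q > 0 \<and> (\<forall>\<alpha> \<beta>. 0 \<le> \<beta> \<longrightarrow> \<beta> \<le> 1 \<longrightarrow> \<alpha> = 1 - \<beta> \<longrightarrow>
      \<bar>prim_sum \<alpha> \<beta> Q / prim_sum 0 1 Q - (1 - \<alpha> * \<beta>)\<bar> \<le> \<delta>)"
    using prim_sum_ratio[OF \<delta>(1)] by blast
  have "infdist z limit_curve < \<epsilon>" if Q: "Q > Q0" and z: "z \<in> scaled_jarnik_polygon Q diamond" for Q z
  proof -
    have Qpos: "Q > 0" and pos: "prim_sum 0 1 Q > 0" using Q Q0 by auto
    have ratio: "\<bar>prim_sum \<alpha> \<beta> Q / prim_sum 0 1 Q - (1 - \<bar>\<alpha>\<bar> * \<bar>\<beta>\<bar>)\<bar> \<le> \<delta>" if "\<bar>\<alpha>\<bar> + \<bar>\<beta>\<bar> = 1" for \<alpha> \<beta>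
    proof -
      have "0 \<le> \<bar>\<beta>\<bar>" "\<bar>\<beta>\<bar> \<le> 1" "\<bar>\<alpha>\<bar> = 1 - \<bar>\<beta>\<bar>" using that by auto
      then show ?thesis
        unfolding prim_sum_abs[OF Qpos, of \<alpha> \<beta>] using Q0 Q by blast
    qed
    obtain \<alpha>0 \<beta>0 where ab: "\<bar>\<alpha>0\<bar> + \<bar>\<beta>0\<bar> = 1"
      "\<alpha>0 * fst z + \<beta>0 * snd z = prim_sum \<alpha>0 \<beta>0 Q / prim_sum 0 1 Q"
      using scaled_polygon_support(2)[OF Qpos pos z] by blast
    have "infdist (fst z, snd z) limit_curve \<le> 18 * \<delta>"
    proof (rule infdist_limit_curve_le[OF \<delta>(1,2) _ ab(1)])
      fix \<alpha> \<beta> :: real assume "\<bar>\<alpha>\<bar> + \<bar>\<beta>\<bar> = 1"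
      then show "\<alpha> * fst z + \<beta> * snd z \<le> 1 - \<bar>\<alpha>\<bar> * \<bar>\<beta>\<bar> + \<delta>"
        using ratio[of \<alpha> \<beta>] scaled_polygon_support(1)[OF Qpos pos z, of \<alpha> \<beta>] by linarith
    next
      show "1 - \<bar>\<alpha>0\<bar> * \<bar>\<beta>0\<bar> - \<delta> \<le> \<alpha>0 * fst z + \<beta>0 * snd z"
        using ratio[OF ab(1)] ab(2) by linarith
    qed
    then show ?thesis using \<delta>(3) by simp
  qed
  then show "\<exists>Q0. \<forall>Q>Q0. \<forall>z\<in>scaled_jarnik_polygon Q diamond. infdist z limit_curve < \<epsilon>"
    by blast
qed

end
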